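(* Let $(X,T,\mathcal{A},\mu)$ be an ergodic dynamical system, with $X$ a compact metric space enclosed in $\mathbb{R}^n$. Then for every grid $\theta\in\Theta$ (each relation holding both with all superscripts $+$ and with all superscripts $-$): $$D^{\pm}_\tau(q)\le\Delta^{\pm}_\tau(\theta,q)\le\Delta^{\pm}_\mu(\theta,q)=D^{\pm}_\mu(q)\quad\text{for } q>0;$$ $$\Delta^{\pm}_\tau(\theta,q)\ge\Delta^{\pm}_\mu(\theta,q)\ge D^{\pm}_\mu(q)\quad\text{for } q\le0;$$ $$\Delta^{\pm}_\tau(\theta,q)\ge D^{\pm}_\tau(q)\quad\text{for } q\le0;$$ and, for $q=0$, $$\Delta^{\pm}_\tau(\theta,0)=\Delta^{\pm}_\mu(\theta,0).$$
   Context: Setting: $X\subset\mathbb{R}^n$ has the Euclidean distance, $T:X\to X$ preserves the probability measure $\mu$ on a suitable sigma-algebra $\mathcal{A}$ of subsets of $X$ (containing balls and boxes). $B_\varepsilon(x)$ is the ball of radius $\varepsilon$ centered at $x$. For $A\in\mathcal{A}$ and $x\in A$, $\tau_A(x)=\inf\{m>0:\ T^m(x)\in A\}$ is the first return time. Generalized dimensions: for $q\neq1$ let $\Gamma_\mu(\varepsilon,q)=\int_X[\mu(B_\varepsilon(x))]^{q-1}d\mu(x)$ and $\Gamma_\tau(\varepsilon,q)=\int_X[\tau_{B_\varepsilon(x)}(x)]^{1-q}d\mu(x)$; let $\Gamma^l_\mu(\varepsilon)=\int_X\log[\mu(B_\varepsilon(x))]d\mu(x)$ and $\Gamma^l_\tau(\varepsilon)=\int_X\log[\tau^{-1}_{B_\varepsilon(x)}(x)]d\mu(x)$.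 For $\sigma\in\{\mu,\tau\}$ and $q\ne1$, $D^+_\sigma(q)$ and $D^-_\sigma(q)$ are the limsup and liminf, as $\varepsilon\to0$, of $\frac{1}{q-1}\frac{\log\Gamma_\sigma(\varepsilon,q)}{\log\varepsilon}$; for $q=1$ they are the limsup and liminf of $\Gamma^l_\sigma(\varepsilon)/\log\varepsilon$. Grids: a grid $\theta$ is a choice of an origin and an orthonormal orientation in $\mathbb{R}^n$; $\Theta$ is the set of all grids. For each $\varepsilon>0$, $\theta$ determines the lattice partition into hypercubic (half-open) boxes $A_j$, $j=0,1,\dots$, of side $\varepsilon$, with the origin of $\theta$ as a box corner and sides along the directions of $\theta$ (boxes are understood intersected with $X$). Box dimensions: for $q\ne1$ let $\Upsilon_\mu(\theta,\varepsilon,q)=\sum_{j:\mu(A_j)>0}\mu(A_j)^q$ and $\Upsilon_\tau(\theta,\varepsilon,q)=\sum_j\int_{A_j}\tau_{A_j}^{1-q}(x)\,d\mu(x)$; let $\Upsilon^l_\mu(\theta,\varepsilon)=\sum_{j:\mu(A_j)>0}\mu(A_j)\log[\mu(A_j)]$ and $\Upsilon^l_\tau(\theta,\varepsilon)=\sum_j\int_{A_j}\log[\tau_{A_j}^{-1}(x)]\,d\mu(x)$. For $\sigma\in\{\mu,\tau\}$ and $q\neq1$, $\Delta^+_\sigma(\theta,q)$ and $\Delta^-_\sigma(\theta,q)$ are the limsup and liminf, as $\varepsilon\to0$, of $\frac{1}{q-1}\frac{\log\Upsilon_\sigma(\theta,\varepsilon,q)}{\log\varepsilon}$; for $q=1$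 they are the limsup and liminf of $\Upsilon^l_\sigma(\theta,\varepsilon)/\log\varepsilon$. Convention: a partition function whose integrand is not summable has value $+\infty$, and then the corresponding dimension is $+\infty$. *)

theory Defs
  imports "HOL-Probability.Probability"
begin

section \<open>Logarithm, powers and integrals with extended real values\<close>

definition eln :: "ennreal \<Rightarrow> ereal" where
  "eln x = (if x = 0 then -\<infinity> else if x = \<infinity> then \<infinity> else ereal (ln (enn2real x)))"

definition epowr :: "ennreal \<Rightarrow> real \<Rightarrow> ennreal" where
  "epowr x p =
    (if p = 0 then 1
     else if x = 0 then (if p > 0 then 0 else \<infinity>)
     else if x = \<infinity> then (if p > 0 then \<infinity> else 0)
     else ennreal (enn2real x powr p))"

text \<open>
  Positive part minus negative part. All integrands below are nonpositive, so
  \<open>\<infinity> - \<infinity>\<close> does not occur, and the integral of a non-summable integrand is \<open>-\<infinity>\<close>;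
  after division by \<open>ln \<epsilon> < 0\<close> it becomes \<open>+\<infinity>\<close>.
\<close>
definition ext_integral :: "'a measure \<Rightarrow> ('a \<Rightarrow> ereal) \<Rightarrow> ereal" where
  "ext_integral M f =
    enn2ereal (\<integral>\<^sup>+x. e2ennreal (f x) \<partial>M) - enn2ereal (\<integral>\<^sup>+x. e2ennreal (- f x) \<partial>M)"


section \<open>Grids\<close>

text \<open>A grid is a pair of an origin and an orthonormal frame.\<close>
type_synonym 'n grid = "(real ^ 'n) \<times> ('n \<Rightarrow> real ^ 'n)"

definition grids :: "'n::finite grid set" where
  "grids = {(p, e). \<forall>i j. e i \<bullet> e j = (if i = j then 1 else 0)}"

definition grid_box :: "'n::finite grid \<Rightarrow> real \<Rightarrow> ('n \<Rightarrow> int) \<Rightarrow> (real ^ 'n) set" where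
  "grid_box \<theta> \<epsilon> k =
    {x. \<forall>i. of_int (k i) * \<epsilon> \<le> (x - fst \<theta>) \<bullet> snd \<theta> i \<and>
            (x - fst \<theta>) \<bullet> snd \<theta> i < (of_int (k i) + 1) * \<epsilon>}"


section \<open>Ergodic systems in Euclidean space\<close>

locale euclidean_system = prob_space M
  for X :: "(real ^ 'n::finite) set" and T :: "real ^ 'n \<Rightarrow> real ^ 'n"
    and M :: "(real ^ 'n) measure" +
  assumes space_eq: "space M = X"
    and sets_ball: "\<And>x \<epsilon>. x \<in> X \<Longrightarrow> \<epsilon> > 0 \<Longrightarrow> ball x \<epsilon> \<inter> X \<in> sets M"
    and sets_grid_box: "\<And>\<theta> \<epsilon> k. \<theta> \<in> grids \<Longrightarrow> \<epsilon> > 0 \<Longrightarrow> grid_box \<theta> \<epsilon> k \<inter> X \<in> sets M"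
    and measurable_T: "T \<in> M \<rightarrow>\<^sub>M M"
    and invariant: "distr M M T = M"

locale ergodic_system = euclidean_system X T M
  for X :: "(real ^ 'n::finite) set" and T :: "real ^ 'n \<Rightarrow> real ^ 'n"
    and M :: "(real ^ 'n) measure" +
  assumes ergodic:
    "\<And>A. A \<in> sets M \<Longrightarrow> T -` A \<inter> X = A \<Longrightarrow> prob A = 0 \<or> prob A = 1"

text \<open>The value is \<open>\<infinity>\<close> at points that never return.\<close>
definition return_time :: "('a \<Rightarrow> 'a) \<Rightarrow> 'a set \<Rightarrow> 'a \<Rightarrow> ennreal" where
  "return_time T A x = (INF m \<in> {m. m > 0 \<and> (T ^^ m) x \<in> A}. of_nat m)"


section \<open>Partition functions\<close>

context
  fixes M :: "(real ^ 'n::finite) measure" and T :: "real ^ 'n \<Rightarrow> real ^ 'n"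
begin

definition ball_on :: "real ^ 'n \<Rightarrow> real \<Rightarrow> (real ^ 'n) set" where
  "ball_on x \<epsilon> = ball x \<epsilon> \<inter> space M"

definition box_on :: "'n grid \<Rightarrow> real \<Rightarrow> ('n \<Rightarrow> int) \<Rightarrow> (real ^ 'n) set" where
  "box_on \<theta> \<epsilon> k = grid_box \<theta> \<epsilon> k \<inter> space M"

definition Gamma_mu :: "real \<Rightarrow> real \<Rightarrow> ennreal" where
  "Gamma_mu q \<epsilon> = (\<integral>\<^sup>+x. epowr (emeasure M (ball_on x \<epsilon>)) (q - 1) \<partial>M)"

definition Gamma_tau :: "real \<Rightarrow> real \<Rightarrow> ennreal" where
  "Gamma_tau q \<epsilon> = (\<integral>\<^sup>+x. epowr (return_time T (ball_on x \<epsilon>) x) (1 - q) \<partial>M)"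

definition Gamma_log_mu :: "real \<Rightarrow> ereal" where
  "Gamma_log_mu \<epsilon> = ext_integral M (\<lambda>x. eln (emeasure M (ball_on x \<epsilon>)))"

definition Gamma_log_tau :: "real \<Rightarrow> ereal" where
  "Gamma_log_tau \<epsilon> = ext_integral M (\<lambda>x. eln (inverse (return_time T (ball_on x \<epsilon>) x)))"

definition Upsilon_mu :: "'n grid \<Rightarrow> real \<Rightarrow> real \<Rightarrow> ennreal" where
  "Upsilon_mu \<theta> q \<epsilon> =
    (\<Sum>\<^sub>\<infinity>k | measure M (box_on \<theta> \<epsilon> k) > 0. ennreal (measure M (box_on \<theta> \<epsilon> k) powr q))"

definition Upsilon_tau :: "'n grid \<Rightarrow> real \<Rightarrow> real \<Rightarrow> ennreal" where
  "Upsilon_tau \<theta> q \<epsilon> =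
    (\<Sum>\<^sub>\<infinity>k. \<integral>\<^sup>+x\<in>box_on \<theta> \<epsilon> k. epowr (return_time T (box_on \<theta> \<epsilon> k) x) (1 - q) \<partial>M)"

definition Upsilon_log_mu :: "'n grid \<Rightarrow> real \<Rightarrow> ereal" where
  "Upsilon_log_mu \<theta> \<epsilon> =
    (\<Sum>\<^sub>\<infinity>k | measure M (box_on \<theta> \<epsilon> k) > 0.
       ereal (measure M (box_on \<theta> \<epsilon> k) * ln (measure M (box_on \<theta> \<epsilon> k))))"

definition Upsilon_log_tau :: "'n grid \<Rightarrow> real \<Rightarrow> ereal" where
  "Upsilon_log_tau \<theta> \<epsilon> =
    (\<Sum>\<^sub>\<infinity>k. ext_integral M (\<lambda>x. eln (inverse (return_time T (box_on \<theta> \<epsilon> k) x)) *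
                                indicator (box_on \<theta> \<epsilon> k) x))"

end


section \<open>Dimensions\<close>

text \<open>\<open>Upper\<close> and \<open>Lower\<close> stand for the superscripts \<open>+\<close> and \<open>-\<close>.\<close>
datatype side = Upper | Lower

fun scale_limit :: "side \<Rightarrow> (real \<Rightarrow> ereal) \<Rightarrow> ereal" where
  "scale_limit Upper f = Limsup (at_right 0) f"
| "scale_limit Lower f = Liminf (at_right 0) f"

text \<open>
  \<open>F\<close> is the partition function for the exponent \<open>q \<noteq> 1\<close>, \<open>L\<close> its logarithmic
  counterpart for \<open>q = 1\<close>. If \<open>F \<epsilon> = \<infinity>\<close>, which happens only for \<open>q < 1\<close>, the quotient
  at \<open>\<epsilon> < 1\<close> is \<open>+\<infinity>\<close>.
\<close>
definition dimension :: "side \<Rightarrow> real \<Rightarrow> (real \<Rightarrow> ennreal) \<Rightarrow> (real \<Rightarrow> ereal) \<Rightarrow> ereal" where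
  "dimension s q F L =
    (if q = 1 then scale_limit s (\<lambda>\<epsilon>. L \<epsilon> / ereal (ln \<epsilon>))
     else scale_limit s (\<lambda>\<epsilon>. ereal (1 / (q - 1)) * (eln (F \<epsilon>) / ereal (ln \<epsilon>))))"

definition D_mu :: "side \<Rightarrow> (real ^ 'n::finite) measure \<Rightarrow> real \<Rightarrow> ereal" where
  "D_mu s M q = dimension s q (Gamma_mu M q) (Gamma_log_mu M)"

definition D_tau ::
    "side \<Rightarrow> (real ^ 'n::finite) measure \<Rightarrow> (real ^ 'n \<Rightarrow> real ^ 'n) \<Rightarrow> real \<Rightarrow> ereal" where
  "D_tau s M T q = dimension s q (Gamma_tau M T q) (Gamma_log_tau M T)"

definition Delta_mu ::
    "side \<Rightarrow> (real ^ 'n::finite) measure \<Rightarrow> 'n grid \<Rightarrow> real \<Rightarrow> ereal" where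
  "Delta_mu s M \<theta> q = dimension s q (Upsilon_mu M \<theta> q) (Upsilon_log_mu M \<theta>)"

definition Delta_tau ::
    "side \<Rightarrow> (real ^ 'n::finite) measure \<Rightarrow> (real ^ 'n \<Rightarrow> real ^ 'n) \<Rightarrow> 'n grid \<Rightarrow> real \<Rightarrow> ereal" where
  "Delta_tau s M T \<theta> q = dimension s q (Upsilon_tau M T \<theta> q) (Upsilon_log_tau M T \<theta>)"

end

theory Submission
  imports Defs "HOL-Real_Asymp.Real_Asymp"
begin

text \<open>
  Each of the four partition functions is an integral of \<open>g powr (1 - q)\<close> (or of \<open>ln g\<close> if
  \<open>q = 1\<close>), where \<open>g x \<ge> 1\<close> is the return time, or the inverse of the measure, of the ball around
  \<open>x\<close> or of the box containing \<open>x\<close>; so the associated Renyi-type quantity is monotone in \<open>g\<close>.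
  A box of side \<open>\<epsilon>\<close> lies in the ball of radius \<open>n \<epsilon>\<close> around any of its points, which gives
  \<open>D \<le> \<Delta>\<close>. On a box \<open>A\<close> of positive measure the return time has mean \<open>1 / \<mu> A\<close> by Kac's lemma,
  and Jensen's inequality compares the two box dimensions. Finally, a ball of radius \<open>\<epsilon>\<close> lies in
  the union of the \<open>3 ^ n\<close> boxes adjacent to the one containing its centre, which for \<open>q > 0\<close>
  bounds the box partition function by the ball one up to a constant factor.
\<close>

section \<open>Growth rates and Renyi-type quantities\<close>

lemma scale_limit_mono:
  assumes "\<forall>\<^sub>F \<epsilon> in at_right 0. f \<epsilon> \<le> g \<epsilon>"
  shows "scale_limit s f \<le> scale_limit s g"
  using assms by (cases s) (auto intro: Limsup_mono Liminf_mono)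

lemma scale_limit_cong:
  assumes "\<forall>\<^sub>F \<epsilon> in at_right 0. f \<epsilon> = g \<epsilon>"
  shows "scale_limit s f = scale_limit s g"
  using assms by (cases s) (auto intro: Limsup_eq Liminf_eq)

lemma scale_limit_rescale:
  assumes "0 < r"
  shows "scale_limit s (\<lambda>\<epsilon>. f (r * \<epsilon>)) = scale_limit s f"
proof -
  have "inj ((*) r)"
    using assms by (auto intro: injI)
  then show ?thesis
    using Limsup_filtermap_eq[of "(*) r" "at_right 0" f] Liminf_filtermap_eq[of "(*) r" "at_right 0" f]
      filtermap_times_pos_at_right[OF assms, of 0]
    by (cases s) simp_all
qed

lemma scale_limit_affine:
  assumes "0 \<le> c"
  shows "scale_limit s (\<lambda>\<epsilon>. ereal c * f \<epsilon> + ereal d) = ereal c * scale_limit s f + ereal d"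
  using assms
  by (cases s)
     (simp_all add: Limsup_add_ereal_right Liminf_add_ereal_right Limsup_ereal_mult_left
       Liminf_ereal_mult_left)

text \<open>For finite \<open>y\<close> the error \<open>\<delta> * (y + 1)\<close> tends to 0 with
  \<delta>; an infinite \<open>y\<close> is left unchanged by the factor \<open>1 + \<delta>\<close>
  and the summand \<delta>.\<close>

lemma ereal_le_affine_imp_le:
  fixes x y :: ereal
  assumes "\<And>\<delta>. 0 < \<delta> \<Longrightarrow> x \<le> ereal (1 + \<delta>) * y + ereal \<delta>"
  shows "x \<le> y"
proof (cases y)
  case (real b)
  show ?thesis
  proof (rule ereal_le_epsilon2)
    fix e :: real assume "0 < e"
    define \<delta> where "\<delta> = e / (1 + \<bar>b\<bar>)"
    have "0 < \<delta>" using \<open>0 < e\<close> by (simp add: \<delta>_def add_pos_nonneg)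
    have "x \<le> ereal ((1 + \<delta>) * b + \<delta>)"
      using assms[OF \<open>0 < \<delta>\<close>] real by simp
    also have "(1 + \<delta>) * b + \<delta> \<le> b + \<delta> * (1 + \<bar>b\<bar>)"
      using \<open>0 < \<delta>\<close> by (simp add: algebra_simps)
    also have "b + \<delta> * (1 + \<bar>b\<bar>) = b + e"
      by (simp add: \<delta>_def add_pos_nonneg)
    finally show "x \<le> y + ereal e" using real by simp
  qed
next
  case MInf
  then show ?thesis using assms[of 1] by simp
qed simp

text \<open>As \<epsilon> tends to 0, \<open>ln \<epsilon> / ln (r * \<epsilon>)\<close> tends to 1
  and \<open>C / ln (r * \<epsilon>)\<close> to 0, so neither a fixed change of scale nor an
  additive constant affects growth rates. Nonnegativity of \<open>g\<close> allows the ratio of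
  logarithms to be replaced by its upper bound \<open>1 + \<delta>\<close>.\<close>

lemma scale_limit_quotient_le:
  fixes f g :: "real \<Rightarrow> ereal" and C :: real
  assumes "0 < r" "\<And>\<epsilon>. 0 < \<epsilon> \<Longrightarrow> 0 \<le> g \<epsilon>"
    and le: "\<And>\<epsilon>. 0 < \<epsilon> \<Longrightarrow> f (r * \<epsilon>) \<le> g \<epsilon> + ereal C"
  shows "scale_limit s (\<lambda>\<epsilon>. f \<epsilon> / ereal (- ln \<epsilon>)) \<le> scale_limit s (\<lambda>\<epsilon>. g \<epsilon> / ereal (- ln \<epsilon>))"
proof (rule ereal_le_affine_imp_le)
  fix \<delta> :: real assume "0 < \<delta>"
  have "((\<lambda>\<epsilon>. ln \<epsilon> / ln (r * \<epsilon>)) \<longlongrightarrow> 1) (at_right 0)" "((\<lambda>\<epsilon>. C / - ln (r * \<epsilon>)) \<longlongrightarrow> 0) (at_right 0)"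
    using \<open>0 < r\<close> by real_asymp+
  then have "\<forall>\<^sub>F \<epsilon> in at_right 0. ln \<epsilon> / ln (r * \<epsilon>) < 1 + \<delta>" "\<forall>\<^sub>F \<epsilon> in at_right 0. C / - ln (r * \<epsilon>) < \<delta>"
    using order_tendstoD(2)[of _ 1 _ "1 + \<delta>"] order_tendstoD(2)[of _ 0 _ \<delta>] \<open>0 < \<delta>\<close> by force+
  moreover have "\<forall>\<^sub>F \<epsilon> in at_right 0. 0 < \<epsilon> \<and> ln \<epsilon> < (0::real)"
    by (intro eventually_conj eventually_at_right_less) real_asymp
  moreover have "\<forall>\<^sub>F \<epsilon> in at_right 0. ln (r * \<epsilon>) < (0::real)"
    using \<open>0 < r\<close> by real_asymp
  ultimately have "\<forall>\<^sub>F \<epsilon> in at_right 0. f (r * \<epsilon>) / ereal (- ln (r * \<epsilon>))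
      \<le> ereal (1 + \<delta>) * (g \<epsilon> / ereal (- ln \<epsilon>)) + ereal \<delta>"
  proof eventually_elim
    case (elim \<epsilon>)
    define t u where "t = - ln \<epsilon>" and "u = - ln (r * \<epsilon>)"
    have pos: "0 < t" "0 < u" and tu: "t / u < 1 + \<delta>" "C / u < \<delta>"
      using elim by (simp_all add: t_def u_def)
    have "f (r * \<epsilon>) / ereal u \<le> (g \<epsilon> + ereal C) / ereal u"
      using le[of \<epsilon>] elim pos by (simp add: ereal_divide_right_mono)
    also have "\<dots> \<le> ereal (1 + \<delta>) * (g \<epsilon> / ereal t) + ereal \<delta>"
    proof (cases "g \<epsilon>")
      case (real b)
      then have "0 \<le> b" using assms(2)[of \<epsilon>] elim by simp
      have "(b + C) / u = t / u * (b / t) + C / u"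
        using pos by (simp add: field_simps)
      also have "\<dots> \<le> (1 + \<delta>) * (b / t) + \<delta>"
        using tu \<open>0 \<le> b\<close> pos by (intro add_mono mult_right_mono) simp_all
      finally show ?thesis using real pos by simp
    next
      case PInf
      then show ?thesis using pos \<open>0 < \<delta>\<close> by simp
    next
      case MInf
      then show ?thesis using assms(2)[of \<epsilon>] elim by simp
    qed
    finally show ?case by (simp add: t_def u_def)
  qed
  then have "scale_limit s (\<lambda>\<epsilon>. f (r * \<epsilon>) / ereal (- ln (r * \<epsilon>)))
      \<le> scale_limit s (\<lambda>\<epsilon>. ereal (1 + \<delta>) * (g \<epsilon> / ereal (- ln \<epsilon>)) + ereal \<delta>)"
    by (rule scale_limit_mono)
  then show "scale_limit s (\<lambda>\<epsilon>. f \<epsilon> / ereal (- ln \<epsilon>))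
      \<le> ereal (1 + \<delta>) * scale_limit s (\<lambda>\<epsilon>. g \<epsilon> / ereal (- ln \<epsilon>)) + ereal \<delta>"
    using scale_limit_rescale[OF \<open>0 < r\<close>, of s "\<lambda>\<epsilon>. f \<epsilon> / ereal (- ln \<epsilon>)"]
      scale_limit_affine[of "1 + \<delta>" s "\<lambda>\<epsilon>. g \<epsilon> / ereal (- ln \<epsilon>)" \<delta>] \<open>0 < \<delta>\<close>
    by simp
qed

section \<open>Extended logarithm and power: order and inversion\<close>

lemma eln_mono: "x \<le> y \<Longrightarrow> eln x \<le> eln y"
  by (cases x rule: ennreal_cases; cases y rule: ennreal_cases)
     (auto simp: eln_def ennreal_le_iff top_unique)

lemma eln_1 [simp]: "eln 1 = 0"
  by (simp add: eln_def)

lemma eln_ennreal: "0 < x \<Longrightarrow> eln (ennreal x) = ereal (ln x)"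
  by (simp add: eln_def)

lemma eln_nonneg: "1 \<le> x \<Longrightarrow> 0 \<le> eln x"
  using eln_mono[of 1 x] by simp

lemma eln_inverse: "eln (inverse x) = - eln x"
  by (cases x rule: ennreal_cases) (auto simp: eln_def inverse_ennreal ln_inverse)

lemma epowr_ennreal: "0 < x \<Longrightarrow> epowr (ennreal x) p = ennreal (x powr p)"
  by (simp add: epowr_def)

lemma epowr_1 [simp]: "epowr 1 p = 1"
  by (simp add: epowr_def)

lemma epowr_inverse: "epowr (inverse x) p = epowr x (- p)"
  by (cases x rule: ennreal_cases) (auto simp: epowr_def inverse_ennreal powr_minus inverse_powr)

lemma epowr_mono:
  assumes "0 \<le> p" "x \<le> y"
  shows "epowr x p \<le> epowr y p"
  using assms
  by (cases x rule: ennreal_cases; cases y rule: ennreal_cases)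
     (auto simp: epowr_def ennreal_le_iff top_unique powr_mono2)

lemma ennreal_inverse_antimono: "x \<le> y \<Longrightarrow> inverse y \<le> inverse x" for x y :: ennreal
  by (cases x rule: ennreal_cases; cases y rule: ennreal_cases; cases "x = 0"; cases "y = 0")
     (auto simp: inverse_ennreal top_unique)

lemma epowr_antimono:
  assumes "p \<le> 0" "x \<le> y"
  shows "epowr y p \<le> epowr x p"
  using epowr_mono[of "- p" "inverse y" "inverse x"] assms
  by (simp add: epowr_inverse ennreal_inverse_antimono)

section \<open>Renyi-type quantities and their relation to dimensions\<close>

lemma ereal_mult_left_antimono: "a \<le> 0 \<Longrightarrow> x \<le> y \<Longrightarrow> ereal a * y \<le> ereal a * x"
  using ereal_mult_left_mono[of x y "ereal (- a)"] by (simp flip: uminus_ereal.simps)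

text \<open>When \<open>g\<close> is the inverse measure of the box through a point, this is the
  Renyi entropy of order \<open>q\<close> of the partition, with the Shannon entropy at
  \<open>q = 1\<close>. There \<open>e2ennreal\<close> cuts off negative values, which do not occur
  for \<open>g \<ge> 1\<close>.\<close>

definition renyi :: "'a measure \<Rightarrow> real \<Rightarrow> ('a \<Rightarrow> ennreal) \<Rightarrow> ereal" where
  "renyi M q g =
    (if q = 1 then enn2ereal (\<integral>\<^sup>+x. e2ennreal (eln (g x)) \<partial>M)
     else ereal (1 / (1 - q)) * eln (\<integral>\<^sup>+x. epowr (g x) (1 - q) \<partial>M))"

text \<open>For \<open>q > 1\<close> the exponent \<open>1 - q\<close> and the factor
  \<open>1 / (1 - q)\<close> are both negative, so the two reversals of order cancel.\<close>

lemma renyi_mono: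
  assumes "AE x in M. g x \<le> h x"
  shows "renyi M q g \<le> renyi M q h"
proof -
  consider "q = 1" | "q < 1" | "q > 1" by linarith
  then show ?thesis
  proof cases
    case 1
    then show ?thesis
      using assms
      by (auto simp: renyi_def less_eq_ennreal.rep_eq[symmetric]
          intro!: nn_integral_mono_AE e2ennreal_mono eln_mono)
  next
    case 2
    have "(\<integral>\<^sup>+x. epowr (g x) (1 - q) \<partial>M) \<le> (\<integral>\<^sup>+x. epowr (h x) (1 - q) \<partial>M)"
      using assms 2 by (auto intro!: nn_integral_mono_AE epowr_mono)
    then show ?thesis
      using 2 by (auto simp: renyi_def intro!: ereal_mult_left_mono eln_mono)
  next
    case 3
    have "(\<integral>\<^sup>+x. epowr (h x) (1 - q) \<partial>M) \<le> (\<integral>\<^sup>+x. epowr (g x) (1 - q) \<partial>M)"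
      using assms 3 by (auto intro!: nn_integral_mono_AE epowr_antimono)
    then show ?thesis
      using 3 by (auto simp: renyi_def divide_le_0_iff intro!: ereal_mult_left_antimono eln_mono)
  qed
qed

lemma (in prob_space) renyi_nonneg:
  assumes "AE x in M. 1 \<le> g x"
  shows "0 \<le> renyi M q g"
  using renyi_mono[of "\<lambda>_. 1" g M q] assms
  by (auto simp: renyi_def e2ennreal_neg emeasure_space_1 split: if_splits)

text \<open>The logarithm of \<open>inverse (g x)\<close> is at most 0, so only the negative part of
  the integral survives.\<close>

lemma ext_integral_eln_inverse:
  assumes "\<And>x. x \<in> space M \<Longrightarrow> 1 \<le> g x"
  shows "ext_integral M (\<lambda>x. eln (inverse (g x))) = - enn2ereal (\<integral>\<^sup>+x. e2ennreal (eln (g x)) \<partial>M)"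
proof -
  have "(\<integral>\<^sup>+x. e2ennreal (- eln (g x)) \<partial>M) = (\<integral>\<^sup>+x. 0 \<partial>M)"
    using assms by (intro nn_integral_cong) (simp add: e2ennreal_neg eln_nonneg)
  then show ?thesis
    by (simp add: ext_integral_def eln_inverse zero_ennreal.rep_eq)
qed

text \<open>Moving the sign from \<open>ln \<epsilon>\<close> to the other factor is legitimate as
  soon as \<epsilon> < 1, even at infinite values, and this holds eventually near 0.\<close>

lemma dimension_eq_renyi:
  assumes "\<And>\<epsilon>. 0 < \<epsilon> \<Longrightarrow> F \<epsilon> = (\<integral>\<^sup>+x. epowr (g \<epsilon> x) (1 - q) \<partial>M)"
    and "\<And>\<epsilon>. 0 < \<epsilon> \<Longrightarrow> L \<epsilon> = - enn2ereal (\<integral>\<^sup>+x. e2ennreal (eln (g \<epsilon> x)) \<partial>M)"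
  shows "dimension s q F L = scale_limit s (\<lambda>\<epsilon>. renyi M q (g \<epsilon>) / ereal (- ln \<epsilon>))"
proof -
  have ev: "\<forall>\<^sub>F \<epsilon> in at_right 0. 0 < \<epsilon> \<and> ln \<epsilon> < (0::real)"
    by (intro eventually_conj eventually_at_right_less) real_asymp
  show ?thesis
  proof (cases "q = 1")
    case True
    have "- a / ereal t = a / ereal (- t)" if "t < 0" for a t
      using that by (cases a) auto
    then have "scale_limit s (\<lambda>\<epsilon>. L \<epsilon> / ereal (ln \<epsilon>))
        = scale_limit s (\<lambda>\<epsilon>. renyi M q (g \<epsilon>) / ereal (- ln \<epsilon>))"
      using ev by (intro scale_limit_cong) (auto elim!: eventually_mono simp: assms renyi_def True)
    then show ?thesis by (simp add: dimension_def True)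
  next
    case False
    have "ereal (1 / (q - 1)) * (a / ereal t) = ereal (1 / (1 - q)) * a / ereal (- t)"
      if "t < 0" for a t
      using that False by (cases a) (auto simp: field_simps)
    then have "scale_limit s (\<lambda>\<epsilon>. ereal (1 / (q - 1)) * (eln (F \<epsilon>) / ereal (ln \<epsilon>)))
        = scale_limit s (\<lambda>\<epsilon>. renyi M q (g \<epsilon>) / ereal (- ln \<epsilon>))"
      using ev by (intro scale_limit_cong) (auto elim!: eventually_mono simp: assms renyi_def False)
    then show ?thesis by (simp add: dimension_def False)
  qed
qed

section \<open>Jensen's inequality\<close>

text \<open>Weighted arithmetic-geometric mean inequality for \<open>y\<close> and 1, with weights
  \<open>p\<close> and \<open>1 - p\<close>.\<close>

lemma powr_le_tangent:
  fixes y p :: real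
  assumes "0 < y" "0 \<le> p" "p \<le> 1"
  shows "y powr p \<le> 1 - p + p * y"
  using Youngs_inequality_0[of p "1 - p" y 1] assms by simp

text \<open>For \<open>p \<ge> 1\<close> the concave case is applied to \<open>y powr p\<close> with
  exponent \<open>1 / p\<close>; for \<open>p \<le> 0\<close> Young's inequality is used once more,
  with other weights.\<close>

lemma powr_ge_tangent:
  fixes y p :: real
  assumes "0 < y" "p \<le> 0 \<or> 1 \<le> p"
  shows "1 - p + p * y \<le> y powr p"
proof (cases "1 \<le> p")
  case True
  have "(y powr p) powr (1 / p) \<le> 1 - 1 / p + 1 / p * y powr p"
    using assms True by (intro powr_le_tangent) simp_all
  then have "p * y \<le> p * (1 - 1 / p + 1 / p * y powr p)"
    using True assms by (intro mult_left_mono) (simp_all add: powr_powr)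
  also have "\<dots> = p - 1 + y powr p"
    using True by (simp add: field_simps)
  finally show ?thesis by simp
next
  case False
  then have "p \<le> 0" using assms by simp
  \<comment> \<open>With this weight the geometric mean of \<open>y powr p\<close> and
    \<open>y\<close> is 1, so Young's inequality bounds 1 by their arithmetic mean.\<close>
  define \<alpha> where "\<alpha> = 1 / (1 - p)"
  have \<alpha>: "0 \<le> \<alpha>" "0 \<le> 1 - \<alpha>" "p * \<alpha> + (1 - \<alpha>) = 0" "(1 - \<alpha>) * (1 - p) = - p" "\<alpha> * (1 - p) = 1"
    using \<open>p \<le> 0\<close> by (simp_all add: \<alpha>_def field_simps)
  have "(y powr p) powr \<alpha> * y powr (1 - \<alpha>) \<le> \<alpha> * y powr p + (1 - \<alpha>) * y"
    using assms \<alpha> by (intro Youngs_inequality_0) simp_all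
  then have "1 \<le> \<alpha> * y powr p + (1 - \<alpha>) * y"
    using assms \<alpha>(3) by (simp add: powr_powr powr_add[symmetric])
  then have "1 * (1 - p) \<le> (\<alpha> * y powr p + (1 - \<alpha>) * y) * (1 - p)"
    using \<open>p \<le> 0\<close> by (intro mult_right_mono) simp_all
  also have "\<dots> = (\<alpha> * (1 - p)) * y powr p + ((1 - \<alpha>) * (1 - p)) * y"
    by (simp add: algebra_simps)
  finally show ?thesis
    unfolding \<alpha> by simp
qed

text \<open>
  The hypothesis says that \<open>\<tau> / b\<close> has mean 1 with respect to the weight \<open>b\<^sup>p\<close>, \<open>p = 1 - q\<close>.
  Comparing the power \<open>p\<close> with its tangent at \<open>1\<close> then gives Jensen's inequality.
\<close>
context prob_space
begin

context
  fixes \<tau> b :: "'a \<Rightarrow> real" and q :: real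
  assumes meas [measurable]: "\<tau> \<in> borel_measurable M" "b \<in> borel_measurable M"
    and ge_1: "AE x in M. 1 \<le> \<tau> x" "AE x in M. 1 \<le> b x"
    and finite_b: "(\<integral>\<^sup>+x. ennreal (b x powr (1 - q)) \<partial>M) < \<infinity>"
    and mean: "(\<integral>\<^sup>+x. ennreal (b x powr (1 - q) * (\<tau> x / b x)) \<partial>M) = (\<integral>\<^sup>+x. ennreal (b x powr (1 - q)) \<partial>M)"
begin

lemma nn_integral_epowr_eq:
  "(\<integral>\<^sup>+x. epowr (ennreal (\<tau> x)) (1 - q) \<partial>M) = (\<integral>\<^sup>+x. ennreal (\<tau> x powr (1 - q)) \<partial>M)"
  "(\<integral>\<^sup>+x. epowr (ennreal (b x)) (1 - q) \<partial>M) = (\<integral>\<^sup>+x. ennreal (b x powr (1 - q)) \<partial>M)"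
  using ge_1 by (auto intro!: nn_integral_cong_AE simp: epowr_ennreal)

lemma powr_split: "1 \<le> t \<Longrightarrow> 1 \<le> c \<Longrightarrow> t powr p = c powr p * (t / c) powr p" for t c p :: real
  by (simp add: powr_divide)

text \<open>The tangent bound at \<open>\<tau> x / b x\<close> is multiplied by
  \<open>b x powr (1 - q)\<close> and integrated. For these \<open>q\<close> both coefficients
  \<open>q\<close> and \<open>1 - q\<close> are nonnegative, and by \<open>mean\<close> the two
  integrals they multiply agree.\<close>

lemma nn_integral_powr_le:
  assumes "0 \<le> q" "q \<le> 1"
  shows "(\<integral>\<^sup>+x. ennreal (\<tau> x powr (1 - q)) \<partial>M) \<le> (\<integral>\<^sup>+x. ennreal (b x powr (1 - q)) \<partial>M)"
proof -
  have "(\<integral>\<^sup>+x. ennreal (\<tau> x powr (1 - q)) \<partial>M)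
      \<le> (\<integral>\<^sup>+x. ennreal q * ennreal (b x powr (1 - q))
           + ennreal (1 - q) * ennreal (b x powr (1 - q) * (\<tau> x / b x)) \<partial>M)"
    using ge_1
  proof (intro nn_integral_mono_AE, eventually_elim)
    case (elim x)
    have "b x powr (1 - q) * (\<tau> x / b x) powr (1 - q) \<le> b x powr (1 - q) * (q + (1 - q) * (\<tau> x / b x))"
      using powr_le_tangent[of "\<tau> x / b x" "1 - q"] elim assms by (intro mult_left_mono) simp_all
    then have "\<tau> x powr (1 - q) \<le> q * b x powr (1 - q) + (1 - q) * (b x powr (1 - q) * (\<tau> x / b x))"
      using powr_split[of "\<tau> x" "b x" "1 - q"] elim by (simp add: algebra_simps)
    then show ?case
      using assms elim by (simp flip: ennreal_plus ennreal_mult add: ennreal_leI)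
  qed
  also have "\<dots> = (ennreal q + ennreal (1 - q)) * (\<integral>\<^sup>+x. ennreal (b x powr (1 - q)) \<partial>M)"
    by (simp add: nn_integral_add nn_integral_cmult mean[simplified] distrib_right)
  also have "ennreal q + ennreal (1 - q) = 1"
    using assms by (simp flip: ennreal_plus)
  finally show ?thesis by simp
qed

text \<open>One coefficient of the tangent is nonpositive here: \<open>1 - q\<close> for
  \<open>q \<ge> 1\<close>, \<open>q\<close> for \<open>q \<le> 0\<close>. Subtraction being
  truncated in \<open>ennreal\<close>, that term moves to the other side, and
  \<open>finite_b\<close> lets it be cancelled after integration.\<close>

lemma nn_integral_powr_ge:
  assumes "q \<le> 0 \<or> 1 \<le> q"
  shows "(\<integral>\<^sup>+x. ennreal (b x powr (1 - q)) \<partial>M) \<le> (\<integral>\<^sup>+x. ennreal (\<tau> x powr (1 - q)) \<partial>M)"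
proof -
  let ?I = "\<integral>\<^sup>+x. ennreal (b x powr (1 - q)) \<partial>M"
  have tangent: "AE x in M. (1 - q) * (b x powr (1 - q) * (\<tau> x / b x)) + q * b x powr (1 - q) \<le> \<tau> x powr (1 - q)"
    using ge_1
  proof eventually_elim
    case (elim x)
    have "b x powr (1 - q) * (q + (1 - q) * (\<tau> x / b x)) \<le> b x powr (1 - q) * (\<tau> x / b x) powr (1 - q)"
      using powr_ge_tangent[of "\<tau> x / b x" "1 - q"] elim assms by (intro mult_left_mono) auto
    then show ?case
      using powr_split[of "\<tau> x" "b x" "1 - q"] elim by (simp add: algebra_simps)
  qed
  show ?thesis
  proof (cases "1 \<le> q")
    case True
    have "ennreal q * ?I = (\<integral>\<^sup>+x. ennreal q * ennreal (b x powr (1 - q)) \<partial>M)"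
      by (simp add: nn_integral_cmult)
    also have "\<dots> \<le> (\<integral>\<^sup>+x. ennreal (\<tau> x powr (1 - q))
        + ennreal (q - 1) * ennreal (b x powr (1 - q) * (\<tau> x / b x)) \<partial>M)"
      using tangent ge_1
    proof (intro nn_integral_mono_AE, eventually_elim)
      case (elim x)
      then have "q * b x powr (1 - q) \<le> \<tau> x powr (1 - q) + (q - 1) * (b x powr (1 - q) * (\<tau> x / b x))"
        unfolding left_diff_distrib by linarith
      then show ?case
        using True elim by (simp flip: ennreal_plus ennreal_mult add: ennreal_leI)
    qed
    also have "\<dots> = (\<integral>\<^sup>+x. ennreal (\<tau> x powr (1 - q)) \<partial>M) + ennreal (q - 1) * ?I"
      by (simp add: nn_integral_add nn_integral_cmult mean[simplified])
    finally have "?I + ennreal (q - 1) * ?I \<le> (\<integral>\<^sup>+x. ennreal (\<tau> x powr (1 - q)) \<partial>M) + ennreal (q - 1) * ?I"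
      using True ennreal_plus[of 1 "q - 1"] by (simp add: distrib_right)
    then show ?thesis
      using finite_b by (auto simp: ennreal_add_left_cancel_le ennreal_mult_eq_top_iff add.commute[of _ "ennreal (q - 1) * ?I"])
  next
    case False
    define r where "r = - q"
    have "0 \<le> r" using False assms by (simp add: r_def)
    have "ennreal (1 - q) * ?I = (\<integral>\<^sup>+x. ennreal (1 - q) * ennreal (b x powr (1 - q) * (\<tau> x / b x)) \<partial>M)"
      by (simp add: nn_integral_cmult mean[simplified])
    also have "\<dots> \<le> (\<integral>\<^sup>+x. ennreal (\<tau> x powr (1 - q)) + ennreal r * ennreal (b x powr (1 - q)) \<partial>M)"
      using tangent ge_1
    proof (intro nn_integral_mono_AE, eventually_elim)
      case (elim x)
      then have "(1 - q) * (b x powr (1 - q) * (\<tau> x / b x)) \<le> \<tau> x powr (1 - q) + r * b x powr (1 - q)"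
        unfolding r_def by linarith
      then show ?case
        using \<open>0 \<le> r\<close> False elim by (simp flip: ennreal_plus ennreal_mult add: ennreal_leI)
    qed
    also have "\<dots> = (\<integral>\<^sup>+x. ennreal (\<tau> x powr (1 - q)) \<partial>M) + ennreal r * ?I"
      by (simp add: nn_integral_add nn_integral_cmult)
    finally have "?I + ennreal r * ?I \<le> (\<integral>\<^sup>+x. ennreal (\<tau> x powr (1 - q)) \<partial>M) + ennreal r * ?I"
      using \<open>0 \<le> r\<close> ennreal_plus[of 1 r] by (simp add: r_def distrib_right)
    then show ?thesis
      using finite_b by (auto simp: ennreal_add_left_cancel_le ennreal_mult_eq_top_iff add.commute[of _ "ennreal r * ?I"])
  qed
qed

text \<open>Integration of \<open>ln y \<le> y - 1\<close> at \<open>y = \<tau> x / b x\<close>,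
  whose mean is 1 because the weight \<open>b x powr 0\<close> is 1. The summand 1 is carried on
  both sides to avoid subtraction.\<close>

lemma nn_integral_ln_le:
  assumes "q = 1"
  shows "(\<integral>\<^sup>+x. ennreal (ln (\<tau> x)) \<partial>M) \<le> (\<integral>\<^sup>+x. ennreal (ln (b x)) \<partial>M)"
proof -
  have mean1: "(\<integral>\<^sup>+x. ennreal (\<tau> x / b x) \<partial>M) = 1"
  proof -
    have "(\<integral>\<^sup>+x. ennreal (\<tau> x / b x) \<partial>M) = (\<integral>\<^sup>+x. ennreal (b x powr (1 - q) * (\<tau> x / b x)) \<partial>M)"
      using ge_1 by (intro nn_integral_cong_AE, eventually_elim) (simp add: assms)
    also have "\<dots> = (\<integral>\<^sup>+x. 1 \<partial>M)"
      unfolding mean using ge_1 by (intro nn_integral_cong_AE, eventually_elim) (simp add: assms)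
    finally show ?thesis by (simp add: emeasure_space_1)
  qed
  have "(\<integral>\<^sup>+x. ennreal (ln (\<tau> x)) \<partial>M) + 1 = (\<integral>\<^sup>+x. ennreal (ln (\<tau> x)) + 1 \<partial>M)"
    by (simp add: nn_integral_add emeasure_space_1)
  also have "\<dots> \<le> (\<integral>\<^sup>+x. ennreal (ln (b x)) + ennreal (\<tau> x / b x) \<partial>M)"
    using ge_1
  proof (intro nn_integral_mono_AE, eventually_elim)
    case (elim x)
    have "ln (\<tau> x) + 1 \<le> ln (b x) + \<tau> x / b x"
      using ln_le_minus_one[of "\<tau> x / b x"] elim by (simp add: ln_div)
    then show ?case
      using elim by (simp flip: ennreal_plus ennreal_1 add: ennreal_leI)
  qed
  also have "\<dots> = (\<integral>\<^sup>+x. ennreal (ln (b x)) \<partial>M) + 1"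
    by (simp add: nn_integral_add mean1)
  finally show ?thesis
    by (simp add: ennreal_add_left_cancel_le add.commute[of _ 1])
qed

text \<open>For \<open>q > 1\<close> the negative factor \<open>1 / (1 - q)\<close> turns the lower
  bound for the integral into an upper bound. Both ranges contain \<open>q = 0\<close>, where they
  give equality.\<close>

lemma renyi_jensen:
  shows "0 \<le> q \<Longrightarrow> renyi M q (\<lambda>x. ennreal (\<tau> x)) \<le> renyi M q (\<lambda>x. ennreal (b x))"
    and "q \<le> 0 \<Longrightarrow> renyi M q (\<lambda>x. ennreal (b x)) \<le> renyi M q (\<lambda>x. ennreal (\<tau> x))"
proof -
  show "renyi M q (\<lambda>x. ennreal (b x)) \<le> renyi M q (\<lambda>x. ennreal (\<tau> x))" if "q \<le> 0"
    using nn_integral_powr_ge that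
    by (auto simp: renyi_def nn_integral_epowr_eq intro!: ereal_mult_left_mono eln_mono)
  assume "0 \<le> q"
  consider "q = 1" | "q < 1" | "q > 1" by linarith
  then show "renyi M q (\<lambda>x. ennreal (\<tau> x)) \<le> renyi M q (\<lambda>x. ennreal (b x))"
  proof cases
    case 1
    have "(\<integral>\<^sup>+x. e2ennreal (eln (ennreal (\<tau> x))) \<partial>M) = (\<integral>\<^sup>+x. ennreal (ln (\<tau> x)) \<partial>M)"
      "(\<integral>\<^sup>+x. e2ennreal (eln (ennreal (b x))) \<partial>M) = (\<integral>\<^sup>+x. ennreal (ln (b x)) \<partial>M)"
      using ge_1 by (auto intro!: nn_integral_cong_AE simp: eln_ennreal)
    then show ?thesis
      using nn_integral_ln_le 1 by (simp add: renyi_def less_eq_ennreal.rep_eq)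
  next
    case 2
    then show ?thesis
      using nn_integral_powr_le \<open>0 \<le> q\<close>
      by (auto simp: renyi_def nn_integral_epowr_eq intro!: ereal_mult_left_mono eln_mono)
  next
    case 3
    then show ?thesis
      using nn_integral_powr_ge
      by (auto simp: renyi_def nn_integral_epowr_eq divide_le_0_iff
          intro!: ereal_mult_left_antimono eln_mono)
  qed
qed

end

end

section \<open>Kac's lemma\<close>

lemma return_time_ge_1: "1 \<le> return_time T A x"
  unfolding return_time_def
proof (rule INF_greatest)
  fix m assume "m \<in> {m. 0 < m \<and> (T ^^ m) x \<in> A}"
  then show "1 \<le> (of_nat m :: ennreal)"
    using of_nat_mono[of 1 m] by simp
qed

lemma return_time_antimono: "A \<subseteq> B \<Longrightarrow> return_time T B x \<le> return_time T A x"
  unfolding return_time_def by (intro INF_superset_mono) auto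

text \<open>A natural number counts the naturals below it: the \<open>n\<close>-th term records that
  no return occurs at times 1 to \<open>n\<close>. At a point that never returns all terms are 1 and
  the series diverges.\<close>

lemma return_time_eq_suminf:
  "return_time T A x = (\<Sum>n. indicator {y. \<forall>j<n. (T ^^ Suc j) y \<notin> A} x)"
proof (cases "\<exists>m>0. (T ^^ m) x \<in> A")
  case True
  define m where "m = (LEAST m. 0 < m \<and> (T ^^ m) x \<in> A)"
  have m: "0 < m" "(T ^^ m) x \<in> A"
    using LeastI_ex[OF True] by (simp_all add: m_def)
  have least: "m \<le> k" if "0 < k" "(T ^^ k) x \<in> A" for k
    unfolding m_def using that by (intro Least_le) simp
  have "return_time T A x = of_nat m"
    unfolding return_time_def
    by (rule antisym) (use m least in \<open>auto intro!: INF_lower2[of m] INF_greatest\<close>)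
  moreover have "(\<forall>j<n. (T ^^ Suc j) x \<notin> A) \<longleftrightarrow> n < m" for n
  proof
    assume *: "\<forall>j<n. (T ^^ Suc j) x \<notin> A"
    show "n < m"
    proof (rule ccontr)
      assume "\<not> n < m"
      moreover obtain k where "m = Suc k"
        using m(1) gr0_implies_Suc by blast
      ultimately show False using * m(2) by auto
    qed
  next
    assume "n < m"
    then show "\<forall>j<n. (T ^^ Suc j) x \<notin> A"
      using least by (metis Suc_leI le_less_trans not_less zero_less_Suc)
  qed
  then have "(\<Sum>n. indicator {y. \<forall>j<n. (T ^^ Suc j) y \<notin> A} x) = (\<Sum>n. if n < m then 1 else 0 :: ennreal)"
    by (intro arg_cong[of _ _ suminf] ext) (simp add: indicator_def)
  moreover have "(\<Sum>n. if n < m then 1 else 0 :: ennreal) = of_nat m"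
    by (subst suminf_finite[of "{..<m}"]) auto
  ultimately show ?thesis by simp
next
  case False
  then have "return_time T A x = \<top>"
    by (auto simp: return_time_def)
  moreover have "(\<Sum>n. indicator {y. \<forall>j<n. (T ^^ Suc j) y \<notin> A} x) = (\<Sum>n. 1 :: ennreal)"
    using False by (intro arg_cong[of _ _ suminf] ext) (auto simp: indicator_def)
  moreover have "(\<Sum>n. 1 :: ennreal) = \<top>"
    by (simp add: suminf_eq_SUP ennreal_SUP_of_nat_eq_top)
  ultimately show ?thesis by simp
qed

section \<open>Invariance, ergodicity and the mean return time\<close>

context ergodic_system
begin

lemma funpow_T_measurable [measurable]: "T ^^ m \<in> M \<rightarrow>\<^sub>M M"
  by (rule measurable_compose_n[OF measurable_T])

lemma prob_vimage: "A \<in> sets M \<Longrightarrow> prob (T -` A \<inter> X) = prob A"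
  using measure_distr[OF measurable_T, of A] by (simp add: invariant space_eq)

lemma T_in_X: "x \<in> X \<Longrightarrow> T x \<in> X"
  using measurable_space[OF measurable_T] by (simp add: space_eq)

text \<open>Time 0 counts here, so for \<open>n > 0\<close> the members start outside
  \<open>A\<close>; the preimage under \<open>T\<close> shifts the window to the times 1 to
  \<open>n\<close> that govern the return time.\<close>

definition avoid :: "(real ^ 'n) set \<Rightarrow> nat \<Rightarrow> (real ^ 'n) set" where
  "avoid A n = {x \<in> X. \<forall>j<n. (T ^^ j) x \<notin> A}"

lemma avoid_eq: "avoid A n = {x \<in> space M. \<forall>j<n. (T ^^ j) x \<notin> A}"
  by (simp add: avoid_def space_eq)

lemma vimage_T_measurable: "A \<in> sets M \<Longrightarrow> T -` A \<inter> X \<in> sets M"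
  using measurable_sets[OF measurable_T] by (simp add: space_eq)

lemma vimage_avoid: "T -` avoid A n \<inter> X = {x \<in> X. \<forall>j<n. (T ^^ Suc j) x \<notin> A}"
  unfolding avoid_def funpow_Suc_right o_apply using T_in_X by auto

lemma avoid_Suc: "avoid A (Suc n) = (T -` avoid A n \<inter> X) - A"
  unfolding vimage_avoid unfolding avoid_def All_less_Suc2 by auto

lemma avoid_measurable [measurable]:
  assumes "A \<in> sets M"
  shows "avoid A n \<in> sets M"
proof (induction n)
  case 0
  show ?case by (simp add: avoid_eq)
next
  case (Suc n)
  then show ?case
    unfolding avoid_Suc using assms by (intro sets.Diff vimage_T_measurable)
qed

text \<open>The points whose orbit is eventually outside \<open>A\<close> form an invariant set of the same
  measure as the set of points whose orbit is entirely outside \<open>A\<close>.\<close>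
lemma prob_never_visit:
  assumes A [measurable]: "A \<in> sets M" and "0 < prob A"
  shows "prob (\<Inter>n. avoid A n) = 0"
proof -
  define H where "H = (\<Inter>n. avoid A n)"
  have H_iff: "x \<in> H \<longleftrightarrow> x \<in> X \<and> (\<forall>j. (T ^^ j) x \<notin> A)" for x
    by (auto simp: H_def avoid_def)
  have H [measurable]: "H \<in> sets M"
    unfolding H_def by measurable
  \<comment> \<open>All \<open>G m\<close> have the measure of \<open>H\<close> by invariance, and
    they increase because \<open>T\<close> maps \<open>H\<close> into itself. Hence their union has
    the measure of \<open>H\<close> too; it equals its own preimage under \<open>T\<close>, so
    ergodicity applies to it.\<close>
  define G where "G m = (T ^^ m) -` H \<inter> X" for m
  have G [measurable]: "G m \<in> sets M" for m
    using measurable_sets[OF funpow_T_measurable H] by (simp add: G_def space_eq)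
  have G_Suc: "G (Suc m) = T -` G m \<inter> X" for m
    by (auto simp: G_def T_in_X funpow_swap1)
  have prob_G: "prob (G m) = prob H" for m
  proof (induction m)
    case 0
    have "G 0 = H" using H_iff by (auto simp: G_def)
    then show ?case by simp
  next
    case (Suc m)
    then show ?case by (simp add: G_Suc prob_vimage)
  qed
  have T_H: "x \<in> H \<Longrightarrow> T x \<in> H" for x
    unfolding H_iff by (metis T_in_X funpow_Suc_right o_apply)
  then have "G m \<subseteq> G (Suc m)" for m
    by (auto simp: G_def)
  then have "incseq G"
    by (rule incseq_SucI)
  then have "(\<lambda>m. prob (G m)) \<longlonglongrightarrow> prob (\<Union>m. G m)"
    by (intro finite_Lim_measure_incseq) auto
  then have prob_Un: "prob (\<Union>m. G m) = prob H"
    unfolding prob_G by (simp add: LIMSEQ_const_iff)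
  have "T -` (\<Union>m. G m) \<inter> X = (\<Union>m. G (Suc m))"
    by (auto simp: G_Suc)
  also have "\<dots> = (\<Union>m. G m)"
    using \<open>incseq G\<close> by (force simp: incseq_Suc_iff)
  finally have "prob H = 0 \<or> prob H = 1"
    using ergodic[of "\<Union>m. G m"] prob_Un by (auto simp: sets.countable_UN)
  \<comment> \<open>Full measure of \<open>H\<close> is ruled out because \<open>H\<close>, avoiding
    \<open>A\<close> already at time 0, is disjoint from \<open>A\<close>.\<close>
  moreover have "prob H + prob A \<le> 1"
  proof -
    have "H \<inter> A = {}"
      using H_iff by (metis disjoint_iff funpow_0)
    then show ?thesis
      using finite_measure_Union[of H A] prob_le_1[of "H \<union> A"] by simp
  qed
  ultimately show ?thesis
    using \<open>0 < prob A\<close> by (auto simp: H_def)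
qed

lemma return_time_eq_suminf_avoid:
  "x \<in> space M \<Longrightarrow> return_time T A x = (\<Sum>n. indicator (T -` avoid A n \<inter> X) x)"
  unfolding return_time_eq_suminf vimage_avoid
  by (intro arg_cong[of _ _ suminf] ext) (simp add: indicator_def space_eq)

lemma return_time_measurable:
  assumes [measurable]: "A \<in> sets M"
  shows "return_time T A \<in> borel_measurable M"
proof -
  have [measurable]: "T -` avoid A n \<inter> X \<in> sets M" for n
    by (rule vimage_T_measurable) measurable
  show ?thesis
    by (subst measurable_cong[OF return_time_eq_suminf_avoid]) measurable
qed

text \<open>Among the points of \<open>A\<close>, those with return time above \<open>n\<close> have
  measure \<open>h n - h (Suc n)\<close>: the preimage of \<open>avoid A n\<close> has measure
  \<open>h n\<close>, and removal of its part in \<open>A\<close> leaves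
  \<open>avoid A (Suc n)\<close>. The sum telescopes to \<open>h 0\<close> minus the limit of
  \<open>h\<close>, which is \<open>1 - 0\<close>; ergodicity enters through that limit.\<close>

lemma Kac:
  assumes [measurable]: "A \<in> sets M" and "0 < prob A"
  shows "(\<integral>\<^sup>+x\<in>A. return_time T A x \<partial>M) = 1"
proof -
  define h where "h n = prob (avoid A n)" for n
  define B where "B n = (T -` avoid A n \<inter> X) \<inter> A" for n
  have B [measurable]: "B n \<in> sets M" for n
    unfolding B_def by (intro sets.Int vimage_T_measurable avoid_measurable assms)
  have prob_B: "prob (B n) = h n - h (Suc n)" for n
    unfolding h_def avoid_Suc B_def
    by (subst finite_measure_Diff') (simp_all add: vimage_T_measurable prob_vimage)
  have "h \<longlonglongrightarrow> prob (\<Inter>n. avoid A n)"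
    unfolding h_def
  proof (rule finite_Lim_measure_decseq)
    show "range (avoid A) \<subseteq> sets M"
      using avoid_measurable[OF assms(1)] by blast
    show "decseq (avoid A)"
      unfolding decseq_def avoid_def by force
  qed
  then have "h \<longlonglongrightarrow> 0"
    using prob_never_visit[OF assms] by simp
  then have "(\<lambda>n. h n - h (Suc n)) sums (h 0 - 0)"
    by (rule telescope_sums')
  moreover have "h 0 = 1"
    using prob_space by (simp add: h_def avoid_eq)
  ultimately have "(\<lambda>n. prob (B n)) sums 1"
    by (simp add: prob_B)
  have "(\<integral>\<^sup>+x\<in>A. return_time T A x \<partial>M) = (\<integral>\<^sup>+x. (\<Sum>n. indicator (B n) x) \<partial>M)"
  proof (intro nn_integral_cong)
    fix x assume "x \<in> space M"
    then show "return_time T A x * indicator A x = (\<Sum>n. indicator (B n) x)"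
      by (cases "x \<in> A") (simp_all add: return_time_eq_suminf_avoid B_def indicator_inter_arith)
  qed
  also have "\<dots> = (\<Sum>n. emeasure M (B n))"
    by (simp add: nn_integral_suminf)
  also have "\<dots> = ennreal (\<Sum>n. prob (B n))"
    unfolding emeasure_eq_measure
    using \<open>(\<lambda>n. prob (B n)) sums 1\<close> by (intro suminf_ennreal2) (simp_all add: sums_summable)
  finally show ?thesis
    using sums_unique[OF \<open>(\<lambda>n. prob (B n)) sums 1\<close>] by simp
qed

end

section \<open>Grids\<close>

text \<open>That the boxes partition space is immediate once they are the fibres of a single map;
  the floor fits their half-open sides.\<close>

definition grid_index :: "'n::finite grid \<Rightarrow> real \<Rightarrow> real ^ 'n \<Rightarrow> 'n \<Rightarrow> int" where
  "grid_index \<theta> \<epsilon> x i = \<lfloor>((x - fst \<theta>) \<bullet> snd \<theta> i) / \<epsilon>\<rfloor>"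

lemma mem_grid_box_iff:
  assumes "0 < \<epsilon>"
  shows "x \<in> grid_box \<theta> \<epsilon> k \<longleftrightarrow> grid_index \<theta> \<epsilon> x = k"
  using assms
  by (auto simp: grid_box_def grid_index_def fun_eq_iff floor_eq_iff pos_le_divide_eq
      pos_divide_less_eq)

lemma grids_norm: "\<theta> \<in> grids \<Longrightarrow> norm (snd \<theta> i) = 1"
  by (auto simp: grids_def norm_eq_1)

lemma grids_inner_le: "\<theta> \<in> grids \<Longrightarrow> \<bar>x \<bullet> snd \<theta> i\<bar> \<le> norm x"
  using Cauchy_Schwarz_ineq2[of x "snd \<theta> i"] by (simp add: grids_norm)

text \<open>The orthonormal frame vectors are independent, hence a basis by dimension, and the
  triangle inequality applies to the expansion of \<open>z\<close>.\<close>

lemma grids_norm_le: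
  fixes z :: "real ^ 'n::finite"
  assumes "\<theta> \<in> grids"
  shows "norm z \<le> (\<Sum>i\<in>UNIV. \<bar>z \<bullet> snd \<theta> i\<bar>)"
proof -
  let ?e = "snd \<theta>" and ?B = "range (snd \<theta>)"
  have inner: "?e i \<bullet> ?e j = (if i = j then 1 else 0)" for i j
    using assms by (auto simp: grids_def)
  have "inj ?e"
    by (rule injI) (metis inner zero_neq_one)
  have orth: "pairwise orthogonal ?B"
    by (auto simp: pairwise_def orthogonal_def inner)
  have "0 \<notin> ?B"
    using grids_norm[OF assms] by (metis imageE norm_zero zero_neq_one)
  then have "independent ?B"
    using orth by (rule pairwise_orthogonal_independent[rotated])
  moreover have "card ?B = CARD('n)"
    using \<open>inj ?e\<close> by (rule card_image)
  ultimately have "UNIV \<subseteq> span ?B"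
    by (intro card_ge_dim_independent) simp_all
  then have "(\<Sum>b\<in>?B. (z \<bullet> b) *\<^sub>R b) = z"
    using orth grids_norm[OF assms] by (intro orthonormal_basis_expand) auto
  then have "z = (\<Sum>i\<in>UNIV. (z \<bullet> ?e i) *\<^sub>R ?e i)"
    using sum.reindex[OF \<open>inj ?e\<close>, of "\<lambda>b. (z \<bullet> b) *\<^sub>R b"] by simp
  also have "norm \<dots> \<le> (\<Sum>i\<in>UNIV. \<bar>z \<bullet> ?e i\<bar>)"
    by (rule order_trans[OF norm_sum]) (simp add: grids_norm[OF assms])
  finally show ?thesis .
qed

text \<open>Equal floors force coordinates less than \<epsilon> apart; the sum over all coordinates
  accounts for the factor \<open>CARD('n)\<close>.\<close>

lemma grid_index_eq_imp_dist_less: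
  fixes x y :: "real ^ 'n::finite" and \<epsilon> :: real
  assumes "\<theta> \<in> grids" "0 < \<epsilon>" "grid_index \<theta> \<epsilon> x = grid_index \<theta> \<epsilon> y"
  shows "dist x y < CARD('n) * \<epsilon>"
proof -
  have less: "\<bar>(x - y) \<bullet> snd \<theta> i\<bar> < \<epsilon>" for i
  proof -
    have "\<lfloor>((x - fst \<theta>) \<bullet> snd \<theta> i) / \<epsilon>\<rfloor> = \<lfloor>((y - fst \<theta>) \<bullet> snd \<theta> i) / \<epsilon>\<rfloor>"
      using fun_cong[OF assms(3), of i] by (simp add: grid_index_def)
    then have "\<bar>((x - fst \<theta>) \<bullet> snd \<theta> i) / \<epsilon> - ((y - fst \<theta>) \<bullet> snd \<theta> i) / \<epsilon>\<bar> < 1"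
      by linarith
    also have "((x - fst \<theta>) \<bullet> snd \<theta> i) / \<epsilon> - ((y - fst \<theta>) \<bullet> snd \<theta> i) / \<epsilon> = ((x - y) \<bullet> snd \<theta> i) / \<epsilon>"
      by (simp add: inner_diff_left diff_divide_distrib)
    finally show ?thesis
      using \<open>0 < \<epsilon>\<close> by (simp add: abs_divide)
  qed
  have "dist x y \<le> (\<Sum>i\<in>UNIV. \<bar>(x - y) \<bullet> snd \<theta> i\<bar>)"
    unfolding dist_norm by (rule grids_norm_le[OF assms(1)])
  also have "\<dots> < (\<Sum>i\<in>(UNIV :: 'n set). \<epsilon>)"
    using less by (intro sum_strict_mono) simp_all
  finally show ?thesis by simp
qed

text \<open>Offsets from a box to itself and to the boxes touching it, corners included.\<close>

definition neighbours :: "('n::finite \<Rightarrow> int) set" where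
  "neighbours = {d. \<forall>i. d i \<in> {-1, 0, 1}}"

lemma finite_neighbours: "finite (neighbours :: ('n::finite \<Rightarrow> int) set)"
proof -
  have "neighbours = (PiE UNIV (\<lambda>_. {-1, 0, 1}) :: ('n \<Rightarrow> int) set)"
    by (auto simp: neighbours_def PiE_UNIV_domain)
  also have "finite \<dots>" by (intro finite_PiE) simp_all
  finally show ?thesis .
qed

text \<open>A displacement shorter than \<epsilon> changes each coordinate by less than one side, so
  each floor moves by at most 1.\<close>

lemma grid_index_diff_neighbour:
  assumes "\<theta> \<in> grids" "0 < \<epsilon>" "dist x y < \<epsilon>"
  shows "(\<lambda>i. grid_index \<theta> \<epsilon> y i - grid_index \<theta> \<epsilon> x i) \<in> neighbours"
proof -
  have "grid_index \<theta> \<epsilon> y i - grid_index \<theta> \<epsilon> x i \<in> {-1, 0, 1}" for i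
  proof -
    have "\<bar>(y - x) \<bullet> snd \<theta> i\<bar> < \<epsilon>"
      using grids_inner_le[OF assms(1), of "y - x" i] assms(3) by (simp add: dist_norm norm_minus_commute)
    then have "\<bar>((y - fst \<theta>) \<bullet> snd \<theta> i) / \<epsilon> - ((x - fst \<theta>) \<bullet> snd \<theta> i) / \<epsilon>\<bar> < 1"
      using \<open>0 < \<epsilon>\<close> by (simp add: inner_diff_left flip: diff_divide_distrib)
    then have "\<bar>grid_index \<theta> \<epsilon> y i - grid_index \<theta> \<epsilon> x i\<bar> \<le> 1"
      unfolding grid_index_def by linarith
    then show ?thesis by auto
  qed
  then show ?thesis by (simp add: neighbours_def)
qed

text \<open>Frame coordinates are bounded on a bounded set, so only finitely many floors
  occur.\<close>

lemma finite_grid_index_image: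
  fixes X :: "(real ^ 'n::finite) set"
  assumes "\<theta> \<in> grids" "0 < \<epsilon>" "bounded X"
  shows "finite (grid_index \<theta> \<epsilon> ` X)"
proof -
  obtain B where B: "\<And>x. x \<in> X \<Longrightarrow> dist (fst \<theta>) x \<le> B"
    using assms(3) bounded_any_center[of X "fst \<theta>"] by auto
  have "grid_index \<theta> \<epsilon> x i \<in> {\<lfloor>- B / \<epsilon>\<rfloor>..\<lfloor>B / \<epsilon>\<rfloor>}" if "x \<in> X" for x i
  proof -
    have "\<bar>(x - fst \<theta>) \<bullet> snd \<theta> i\<bar> \<le> B"
      using grids_inner_le[OF assms(1), of "x - fst \<theta>" i] B[OF that]
      by (simp add: dist_norm norm_minus_commute)
    then have "- B / \<epsilon> \<le> ((x - fst \<theta>) \<bullet> snd \<theta> i) / \<epsilon>" "((x - fst \<theta>) \<bullet> snd \<theta> i) / \<epsilon> \<le> B / \<epsilon>"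
      using divide_right_mono[of "- B" "(x - fst \<theta>) \<bullet> snd \<theta> i" \<epsilon>]
        divide_right_mono[of "(x - fst \<theta>) \<bullet> snd \<theta> i" B \<epsilon>] \<open>0 < \<epsilon>\<close>
      by simp_all
    then show ?thesis
      by (auto simp: grid_index_def intro!: floor_mono)
  qed
  then have "grid_index \<theta> \<epsilon> ` X \<subseteq> PiE UNIV (\<lambda>_. {\<lfloor>- B / \<epsilon>\<rfloor>..\<lfloor>B / \<epsilon>\<rfloor>})"
    by (auto simp: PiE_UNIV_domain)
  then show ?thesis
    by (rule finite_subset) (simp add: finite_PiE)
qed

section \<open>Comparison of finite sums of powers and logarithms\<close>

lemma powr_sum_le:
  fixes f :: "'i \<Rightarrow> real"
  assumes "finite I" "\<And>i. i \<in> I \<Longrightarrow> 0 \<le> f i" "0 < q"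
  shows "(\<Sum>i\<in>I. f i) powr q \<le> card I powr q * (\<Sum>i\<in>I. f i powr q)"
proof (cases "I = {}")
  case False
  \<comment> \<open>Comparing every term with the largest one covers all \<open>q > 0\<close> at
    once, without separate convexity and concavity arguments.\<close>
  define m where "m = Max (f ` I)"
  have "m \<in> f ` I"
    unfolding m_def using False assms(1) by (intro Max_in) auto
  then obtain j where j: "j \<in> I" "m = f j" by auto
  have "f i \<le> m" if "i \<in> I" for i
    unfolding m_def using that assms(1) by (intro Max_ge) auto
  then have "(\<Sum>i\<in>I. f i) \<le> card I * m"
    using sum_bounded_above[of I f m] by simp
  then have "(\<Sum>i\<in>I. f i) powr q \<le> (card I * m) powr q"
    using assms by (intro powr_mono2 sum_nonneg) auto
  also have "\<dots> = card I powr q * f j powr q"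
    using assms(2) j by (simp add: powr_mult)
  also have "\<dots> \<le> card I powr q * (\<Sum>i\<in>I. f i powr q)"
    using j assms(1) by (intro mult_left_mono member_le_sum) auto
  finally show ?thesis .
qed simp

text \<open>
  The case \<open>q < 1\<close> is the delicate one, as boxes with \<open>a k\<close> much smaller than \<open>S k\<close> spoil a
  termwise comparison. They are harmless because their total contribution to
  \<open>\<Sum>k. a k powr q\<close> is at most \<open>c powr q * (\<Sum>k. S k powr q)\<close>.
\<close>
lemma renyi_sum_comparison:
  fixes q C :: real
  assumes "0 < q" "0 < C"
  obtains D where
    "\<And>(K :: 'k set) a S.
      \<lbrakk>finite K; \<And>k. k \<in> K \<Longrightarrow> 0 < a k; \<And>k. k \<in> K \<Longrightarrow> a k \<le> S k; (\<Sum>k\<in>K. a k) = 1;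
       (\<Sum>k\<in>K. S k powr q) \<le> C * (\<Sum>k\<in>K. a k powr q)\<rbrakk> \<Longrightarrow>
      (if q = 1 then \<Sum>k\<in>K. a k * - ln (a k)
       else 1 / (1 - q) * ln (\<Sum>k\<in>K. a k * a k powr (q - 1)))
      \<le> (if q = 1 then \<Sum>k\<in>K. a k * - ln (S k)
         else 1 / (1 - q) * ln (\<Sum>k\<in>K. a k * S k powr (q - 1))) + D"
proof -
  \<comment> \<open>For \<open>q < 1\<close>, the threshold for \<open>a k / S k\<close> below which
    a term counts as small. Since \<open>c powr q * C\<close> is 1/2, such terms can be discarded at
    the cost of half the sum.\<close>
  define c where "c = (1 / (2 * C)) powr (1 / q)"
  have "0 < c" and c_q: "c powr q * C = 1 / 2"
    using assms by (simp_all add: c_def powr_powr)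
  \<comment> \<open>Only \<open>q\<close> and \<open>C\<close> enter, so the same constant serves
    every \<open>K\<close>, \<open>a\<close> and \<open>S\<close>, and later every scale.\<close>
  define D where "D = (if q = 1 then C - 1 else if 1 < q then ln C / (q - 1)
    else ln (2 / c powr (1 - q)) / (1 - q))"
  have "(if q = 1 then \<Sum>k\<in>K. a k * - ln (a k)
       else 1 / (1 - q) * ln (\<Sum>k\<in>K. a k * a k powr (q - 1)))
      \<le> (if q = 1 then \<Sum>k\<in>K. a k * - ln (S k)
         else 1 / (1 - q) * ln (\<Sum>k\<in>K. a k * S k powr (q - 1))) + D"
    if "finite K" and a: "\<And>k. k \<in> K \<Longrightarrow> 0 < a k" and S: "\<And>k. k \<in> K \<Longrightarrow> a k \<le> S k"
      and sum_a: "(\<Sum>k\<in>K. a k) = 1"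
      and le: "(\<Sum>k\<in>K. S k powr q) \<le> C * (\<Sum>k\<in>K. a k powr q)"
    for K :: "'k set" and a S
  proof -
    define F G where "F = (\<Sum>k\<in>K. a k powr q)" and "G = (\<Sum>k\<in>K. a k * S k powr (q - 1))"
    have a_powr: "a k * a k powr (q - 1) = a k powr q" if "k \<in> K" for k
      using a[OF that] by (simp add: powr_diff)
    have S_powr: "S k * S k powr (q - 1) = S k powr q" if "k \<in> K" for k
      using a[OF that] S[OF that] by (simp add: powr_diff)
    have S_pos: "0 < S k" if "k \<in> K" for k
      using a[OF that] S[OF that] by simp
    have "K \<noteq> {}" using sum_a by auto
    then have pos: "0 < F" "0 < G"
      unfolding F_def G_def using \<open>finite K\<close> a S_pos
      by (auto intro!: sum_pos mult_pos_pos simp: less_imp_neq[symmetric])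
    consider "q = 1" | "1 < q" | "q < 1" by linarith
    then show ?thesis
    proof cases
      case 1
      \<comment> \<open>This is \<open>ln y \<le> y - 1\<close> at \<open>y = S k / a k\<close>; the
        excess \<open>S k - a k\<close> sums to at most \<open>C - 1\<close>.\<close>
      have "a k * - ln (a k) \<le> a k * - ln (S k) + (S k - a k)" if "k \<in> K" for k
      proof -
        have "a k * (ln (S k) - ln (a k)) \<le> a k * (S k / a k - 1)"
          using a[OF that] S_pos[OF that] ln_le_minus_one[of "S k / a k"]
          by (intro mult_left_mono) (simp_all add: ln_div)
        also have "\<dots> = S k - a k" using a[OF that] by (simp add: field_simps)
        finally show ?thesis by (simp add: algebra_simps)
      qed
      then have "(\<Sum>k\<in>K. a k * - ln (a k)) \<le> (\<Sum>k\<in>K. a k * - ln (S k) + (S k - a k))"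
        by (rule sum_mono)
      also have "\<dots> = (\<Sum>k\<in>K. a k * - ln (S k)) + ((\<Sum>k\<in>K. S k) - 1)"
        by (simp add: sum.distrib sum_subtractf sum_negf sum_a)
      also have "(\<Sum>k\<in>K. S k) = (\<Sum>k\<in>K. S k powr q)" "(\<Sum>k\<in>K. a k powr q) = 1"
        using a S_pos 1 sum_a by (simp_all add: less_imp_le)
      then have "(\<Sum>k\<in>K. S k) - 1 \<le> D"
        using le 1 by (simp add: D_def)
      finally show ?thesis using 1 by simp
    next
      case 2
      \<comment> \<open>Since \<open>a k \<le> S k\<close>, the factor \<open>a k\<close> may be
        enlarged to \<open>S k\<close>.\<close>
      have "G \<le> (\<Sum>k\<in>K. S k powr q)"
        unfolding G_def
        using S S_powr by (intro sum_mono) (metis mult_right_mono powr_ge_zero)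
      then have "ln G \<le> ln (C * F)"
        using le pos \<open>0 < C\<close> by (subst ln_le_cancel_iff) (auto simp: F_def)
      then have "ln G \<le> ln C + ln F"
        using pos \<open>0 < C\<close> by (simp add: ln_mult)
      then have "ln G / (q - 1) \<le> (ln C + ln F) / (q - 1)"
        using 2 by (intro divide_right_mono) simp_all
      moreover have "1 / (1 - q) = - (1 / (q - 1))"
        by (metis minus_diff_eq minus_divide_right)
      ultimately have "1 / (1 - q) * ln F \<le> 1 / (1 - q) * ln G + ln C / (q - 1)"
        by (simp add: add_divide_distrib)
      then show ?thesis
        using 2 a_powr by (simp add: F_def G_def D_def)
    next
      case 3
      \<comment> \<open>If \<open>a k \<le> c * S k\<close>, the left side is nonpositive. Otherwise
        \<open>S k < a k / c\<close>, and the negative exponent \<open>q - 1\<close> gives the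
        bound.\<close>
      have termwise: "c powr (1 - q) * (a k powr q - c powr q * S k powr q) \<le> a k * S k powr (q - 1)"
        if "k \<in> K" for k
      proof (cases "a k \<le> c * S k")
        case True
        then have "a k powr q \<le> (c * S k) powr q"
          using a[OF that] \<open>0 < q\<close> by (intro powr_mono2) auto
        then have "a k powr q - c powr q * S k powr q \<le> 0"
          using \<open>0 < c\<close> S_pos[OF that] by (simp add: powr_mult)
        then have "c powr (1 - q) * (a k powr q - c powr q * S k powr q) \<le> 0"
          by (intro mult_nonneg_nonpos) auto
        also have "0 \<le> a k * S k powr (q - 1)"
          using a[OF that] by simp
        finally show ?thesis .
      next
        case False
        then have "S k \<le> a k / c"
          using \<open>0 < c\<close> by (simp add: field_simps)
        then have "(a k / c) powr (q - 1) \<le> S k powr (q - 1)"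
          using S_pos[OF that] 3 by (intro powr_mono2') auto
        then have "a k * (a k / c) powr (q - 1) \<le> a k * S k powr (q - 1)"
          using a[OF that] by (intro mult_left_mono) auto
        moreover have "a k * (a k / c) powr (q - 1) = c powr (1 - q) * a k powr q"
          using a[OF that] \<open>0 < c\<close> a_powr[OF that]
          by (simp add: powr_divide powr_diff field_simps)
        moreover have "c powr (1 - q) * (a k powr q - c powr q * S k powr q) \<le> c powr (1 - q) * a k powr q"
          by (intro mult_left_mono) auto
        ultimately show ?thesis by linarith
      qed
      \<comment> \<open>The subtracted terms amount to at most half of \<open>F\<close>.\<close>
      have "c powr q * (\<Sum>k\<in>K. S k powr q) \<le> c powr q * (C * F)"
        using le by (intro mult_left_mono) (auto simp: F_def)
      also have "\<dots> = F / 2"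
        using c_q by (metis mult.assoc mult.commute mult.right_neutral times_divide_eq_right)
      finally have "c powr (1 - q) * (F / 2) \<le> c powr (1 - q) * (F - c powr q * (\<Sum>k\<in>K. S k powr q))"
        by (intro mult_left_mono) auto
      also have "\<dots> = (\<Sum>k\<in>K. c powr (1 - q) * (a k powr q - c powr q * S k powr q))"
        by (simp add: F_def sum_distrib_left sum_subtractf right_diff_distrib)
      also have "\<dots> \<le> G"
        unfolding G_def using termwise by (intro sum_mono)
      finally have "F \<le> 2 / c powr (1 - q) * G"
        using \<open>0 < c\<close> by (simp add: field_simps)
      then have "ln F \<le> ln (2 / c powr (1 - q) * G)"
        using pos by (subst ln_le_cancel_iff) (use \<open>0 < c\<close> in auto)
      also have "\<dots> = ln (2 / c powr (1 - q)) + ln G"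
        using pos \<open>0 < c\<close> by (intro ln_mult_pos) auto
      finally have "1 / (1 - q) * ln F \<le> 1 / (1 - q) * (ln (2 / c powr (1 - q)) + ln G)"
        using 3 by (intro mult_left_mono) auto
      also have "\<dots> = 1 / (1 - q) * ln G + D"
        using 3 by (simp add: D_def ring_distribs)
      finally show ?thesis
        using 3 a_powr by (simp add: F_def G_def)
    qed
  qed
  then show ?thesis by (rule that)
qed

section \<open>Partition functions of a grid\<close>

lemma epowr_measurable [measurable]: "(\<lambda>x. epowr x p) \<in> borel_measurable borel"
  unfolding epowr_def by measurable

lemma e2ennreal_eln_measurable [measurable]: "(\<lambda>x. e2ennreal (eln x)) \<in> borel_measurable borel"
  unfolding eln_def by measurable

lemma renyi_cong_AE:
  assumes "AE x in M. g x = h x"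
  shows "renyi M q g = renyi M q h"
  using assms by (intro antisym renyi_mono) (auto elim!: eventually_mono)

lemma sum_uminus_enn2ereal:
  "(\<Sum>k\<in>K. - enn2ereal (c k)) = - enn2ereal (\<Sum>k\<in>K. c k)"
proof (induction K rule: infinite_finite_induct)
  case (insert k K)
  have "- enn2ereal a + - enn2ereal b = - enn2ereal (a + b)" for a b
    by (cases a rule: ennreal_cases; cases b rule: ennreal_cases)
       (auto simp: plus_ennreal.rep_eq)
  then show ?case using insert by simp
qed (simp_all add: zero_ennreal.rep_eq)

section \<open>The finite partition into boxes at one scale\<close>

locale grid_system = ergodic_system X T M
  for X :: "(real ^ 'n::finite) set" and T :: "real ^ 'n \<Rightarrow> real ^ 'n"
    and M :: "(real ^ 'n) measure" +
  fixes \<theta> :: "'n grid" and \<epsilon> :: real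
  assumes bounded_X: "bounded X" and grid: "\<theta> \<in> grids" and eps_pos: "0 < \<epsilon>"
begin

abbreviation "cell \<equiv> box_on M \<theta> \<epsilon>"
abbreviation "index \<equiv> grid_index \<theta> \<epsilon>"

definition charged :: "('n \<Rightarrow> int) set" where
  "charged = {k. 0 < prob (cell k)}"

lemma mem_box_iff: "x \<in> cell k \<longleftrightarrow> x \<in> space M \<and> index x = k"
  using eps_pos by (auto simp: box_on_def mem_grid_box_iff)

lemma cell_measurable [measurable]: "cell k \<in> sets M"
  using sets_grid_box[OF grid eps_pos, of k] by (simp add: box_on_def space_eq)

lemma index_measurable [measurable]: "index \<in> M \<rightarrow>\<^sub>M count_space UNIV"
proof -
  have "index -` {k} \<inter> space M = cell k" for k
    by (auto simp: mem_box_iff)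
  then show ?thesis
    by (simp add: measurable_count_space_eq2_countable)
qed

lemma finite_index_image: "finite (index ` space M)"
  using finite_grid_index_image[OF grid eps_pos bounded_X] by (simp add: space_eq)

lemma box_eq_empty: "k \<notin> index ` space M \<Longrightarrow> cell k = {}"
  by (auto simp: mem_box_iff)

lemma charged_subset: "charged \<subseteq> index ` space M"
  using box_eq_empty by (force simp: charged_def)

lemma finite_charged: "finite charged"
  using charged_subset finite_index_image by (rule finite_subset)

lemma infsum_boxes:
  fixes g :: "('n \<Rightarrow> int) \<Rightarrow> 'b::{comm_monoid_add, t2_space}"
  assumes "\<And>k. k \<notin> index ` space M \<Longrightarrow> g k = 0"
  shows "(\<Sum>\<^sub>\<infinity>k. g k) = (\<Sum>k\<in>index ` space M. g k)"
proof -
  have "(\<Sum>\<^sub>\<infinity>k. g k) = (\<Sum>\<^sub>\<infinity>k\<in>index ` space M. g k)"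
    using assms by (intro infsum_cong_neutral) auto
  then show ?thesis
    using finite_index_image by simp
qed

text \<open>On the box \<open>k\<close> the index is constantly \<open>k\<close>, which splits an
  integrand depending on both box and point into ordinary integrals.\<close>

lemma nn_integral_boxes:
  assumes [measurable]: "\<And>k. f k \<in> borel_measurable M"
  shows "(\<integral>\<^sup>+x. f (index x) x \<partial>M) = (\<Sum>k\<in>index ` space M. \<integral>\<^sup>+x\<in>cell k. f k x \<partial>M)"
proof -
  have "f (index x) x = (\<Sum>k\<in>index ` space M. f k x * indicator (cell k) x)" if "x \<in> space M" for x
  proof -
    have "(\<Sum>k\<in>index ` space M. f k x * indicator (cell k) x)
        = (\<Sum>k\<in>index ` space M. if index x = k then f k x else 0)"
      using that by (intro sum.cong) (auto simp: indicator_def mem_box_iff)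
    then show ?thesis
      using that finite_index_image by simp
  qed
  then have "(\<integral>\<^sup>+x. f (index x) x \<partial>M) = (\<integral>\<^sup>+x. (\<Sum>k\<in>index ` space M. f k x * indicator (cell k) x) \<partial>M)"
    by (intro nn_integral_cong)
  also have "\<dots> = (\<Sum>k\<in>index ` space M. \<integral>\<^sup>+x\<in>cell k. f k x \<partial>M)"
    by (intro nn_integral_sum) measurable
  finally show ?thesis .
qed

lemma sum_boxes_eq_sum_charged:
  "(\<Sum>k\<in>index ` space M. w k * emeasure M (cell k)) = (\<Sum>k\<in>charged. w k * ennreal (prob (cell k)))"
proof -
  have "w k * emeasure M (cell k) = 0" if "k \<notin> charged" for k
    using that by (simp add: emeasure_eq_measure charged_def zero_less_measure_iff)
  then have "(\<Sum>k\<in>index ` space M. w k * emeasure M (cell k)) = (\<Sum>k\<in>charged. w k * emeasure M (cell k))"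
    using charged_subset finite_index_image by (intro sum.mono_neutral_right) auto
  then show ?thesis by (simp add: emeasure_eq_measure)
qed

lemma nn_integral_index:
  "(\<integral>\<^sup>+x. w (index x) \<partial>M) = (\<Sum>k\<in>charged. w k * ennreal (prob (cell k)))"
  unfolding sum_boxes_eq_sum_charged[symmetric]
  by (subst nn_integral_boxes) (simp_all add: nn_integral_cmult_indicator)

lemma sum_prob_charged: "(\<Sum>k\<in>charged. prob (cell k)) = 1"
proof -
  have "1 = (\<Sum>k\<in>charged. ennreal (prob (cell k)))"
    using nn_integral_index[of "\<lambda>_. 1"] by (simp add: emeasure_space_1)
  also have "\<dots> = ennreal (\<Sum>k\<in>charged. prob (cell k))"
    by simp
  finally show ?thesis
    by (simp add: ennreal_eq_1)
qed

text \<open>Only finitely many boxes meet the space, so those of measure 0 have a null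
  union.\<close>

lemma AE_index_charged: "AE x in M. index x \<in> charged"
proof -
  have "AE x in M. \<forall>k\<in>index ` space M. x \<in> cell k \<longrightarrow> k \<in> charged"
  proof (intro AE_finite_allI[OF finite_index_image])
    fix k
    show "AE x in M. x \<in> cell k \<longrightarrow> k \<in> charged"
    proof (cases "k \<in> charged")
      case False
      then have "cell k \<in> null_sets M"
        by (auto simp: charged_def emeasure_eq_measure zero_less_measure_iff)
      then have "AE x in M. x \<notin> cell k"
        by (rule AE_not_in)
      then show ?thesis
        by eventually_elim simp
    qed simp
  qed
  then show ?thesis
    using AE_space by eventually_elim (auto simp: mem_box_iff)
qed

section \<open>Return time and inverse measure of the box through a point\<close>

definition tau_box :: "real ^ 'n \<Rightarrow> ennreal" where
  "tau_box x = return_time T (cell (index x)) x"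

text \<open>Together with \<open>tau_box\<close>, it turns sums over boxes into one integral over
  the whole space. On a box of measure 0 its value is infinite, which concerns only a null
  set.\<close>

definition inv_mu_box :: "real ^ 'n \<Rightarrow> ennreal" where
  "inv_mu_box x = inverse (emeasure M (cell (index x)))"

lemma tau_box_ge_1: "1 \<le> tau_box x"
  by (simp add: tau_box_def return_time_ge_1)

lemma return_time_box_measurable [measurable]: "return_time T (cell k) \<in> borel_measurable M"
  by (rule return_time_measurable) measurable

lemma tau_box_measurable [measurable]: "tau_box \<in> borel_measurable M"
  unfolding tau_box_def
  by (rule measurable_compose_countable[OF return_time_box_measurable index_measurable])

text \<open>By Kac's lemma the return time has integral 1 over a charged box, so the factor
  \<open>prob (cell k)\<close> restores the measure of the box; over a box of measure 0 both sides
  vanish. This yields the mean condition of Jensen's inequality.\<close>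

lemma nn_integral_weighted_tau_box:
  "(\<integral>\<^sup>+x. w (index x) * (ennreal (prob (cell (index x))) * tau_box x) \<partial>M) = (\<integral>\<^sup>+x. w (index x) \<partial>M)"
proof -
  have "(\<integral>\<^sup>+x\<in>cell k. w k * (ennreal (prob (cell k)) * return_time T (cell k) x) \<partial>M) = w k * emeasure M (cell k)" for k
  proof -
    have "(\<integral>\<^sup>+x\<in>cell k. w k * (ennreal (prob (cell k)) * return_time T (cell k) x) \<partial>M)
        = w k * (ennreal (prob (cell k)) * (\<integral>\<^sup>+x\<in>cell k. return_time T (cell k) x \<partial>M))"
      by (simp add: mult.assoc nn_integral_cmult)
    also have "\<dots> = w k * emeasure M (cell k)"
      using Kac[of "cell k"] by (cases "prob (cell k) = 0") (auto simp: emeasure_eq_measure zero_less_measure_iff)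
    finally show ?thesis .
  qed
  then show ?thesis
    unfolding tau_box_def
    by (simp add: nn_integral_boxes[of "\<lambda>k x. w k * (ennreal (prob (cell k)) * return_time T (cell k) x)"]
        sum_boxes_eq_sum_charged nn_integral_index)
qed

text \<open>A finite integral forces an almost everywhere finite integrand, and the factor in front
  of \<open>tau_box\<close> is positive on charged boxes.\<close>

lemma AE_tau_box_finite: "AE x in M. tau_box x < \<infinity>"
proof -
  have "(\<integral>\<^sup>+x. ennreal (prob (cell (index x))) * tau_box x \<partial>M) = 1"
    using nn_integral_weighted_tau_box[of "\<lambda>_. 1"] by (simp add: emeasure_space_1)
  then have "AE x in M. ennreal (prob (cell (index x))) * tau_box x \<noteq> \<infinity>"
    by (intro nn_integral_PInf_AE) auto
  with AE_index_charged show ?thesis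
    by eventually_elim (auto simp: charged_def ennreal_mult_eq_top_iff less_top)
qed

text \<open>The integrand is constant on boxes, so the integral is a finite real sum. With
  \<open>v\<close> the measure of a box or of its neighbourhood, this gives the sums compared in
  \<open>renyi_sum_comparison\<close>.\<close>

lemma renyi_index:
  assumes "\<And>k. k \<in> charged \<Longrightarrow> 0 < v k" "\<And>k. k \<in> charged \<Longrightarrow> v k \<le> 1"
  shows "renyi M q (\<lambda>x. inverse (ennreal (v (index x)))) = ereal
    (if q = 1 then \<Sum>k\<in>charged. prob (cell k) * - ln (v k)
     else 1 / (1 - q) * ln (\<Sum>k\<in>charged. prob (cell k) * v k powr (q - 1)))"
proof (cases "q = 1")
  case True
  have "(\<integral>\<^sup>+x. e2ennreal (eln (inverse (ennreal (v (index x))))) \<partial>M)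
      = (\<Sum>k\<in>charged. e2ennreal (eln (inverse (ennreal (v k)))) * ennreal (prob (cell k)))"
    by (rule nn_integral_index)
  also have "\<dots> = (\<Sum>k\<in>charged. ennreal (- ln (v k)) * ennreal (prob (cell k)))"
    using assms by (intro sum.cong) (simp_all add: eln_inverse eln_ennreal)
  also have "\<dots> = (\<Sum>k\<in>charged. ennreal (prob (cell k) * - ln (v k)))"
    by (simp only: ennreal_mult''[OF measure_nonneg, symmetric] mult.commute)
  also have "\<dots> = ennreal (\<Sum>k\<in>charged. prob (cell k) * - ln (v k))"
    using assms by (intro sum_ennreal) (simp add: mult_nonneg_nonpos)
  finally show ?thesis
    using True assms by (simp add: renyi_def sum_nonpos mult_nonneg_nonpos enn2ereal_ennreal sum_negf)
next
  case False
  have "(\<integral>\<^sup>+x. epowr (inverse (ennreal (v (index x)))) (1 - q) \<partial>M)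
      = (\<Sum>k\<in>charged. epowr (inverse (ennreal (v k))) (1 - q) * ennreal (prob (cell k)))"
    by (rule nn_integral_index)
  also have "\<dots> = (\<Sum>k\<in>charged. ennreal (prob (cell k) * v k powr (q - 1)))"
    using assms
    by (intro sum.cong) (simp_all add: epowr_inverse epowr_ennreal mult.commute flip: ennreal_mult)
  also have "\<dots> = ennreal (\<Sum>k\<in>charged. prob (cell k) * v k powr (q - 1))"
    by (intro sum_ennreal) simp
  finally have *: "(\<integral>\<^sup>+x. epowr (inverse (ennreal (v (index x)))) (1 - q) \<partial>M) = \<dots>" .
  have "charged \<noteq> {}"
    using sum_prob_charged by auto
  then have "0 < (\<Sum>k\<in>charged. prob (cell k) * v k powr (q - 1))"
    using finite_charged assms
    by (intro sum_pos) (auto simp: charged_def less_imp_neq[symmetric])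
  then show ?thesis
    using False by (simp add: renyi_def * eln_ennreal)
qed

lemma renyi_tau_box:
  shows "0 \<le> q \<Longrightarrow> renyi M q tau_box \<le> renyi M q inv_mu_box"
    and "q \<le> 0 \<Longrightarrow> renyi M q inv_mu_box \<le> renyi M q tau_box"
proof -
  \<comment> \<open>Real versions for Jensen's inequality. An infinite return time and the inverse
    of measure 0 both become 0, but only on null sets.\<close>
  define \<tau> b where "\<tau> x = enn2real (tau_box x)" and "b x = 1 / prob (cell (index x))" for x
  define w where "w k = ennreal ((1 / prob (cell k)) powr (1 - q))" for k
  have [measurable]: "\<tau> \<in> borel_measurable M" "b \<in> borel_measurable M"
    unfolding \<tau>_def b_def by measurable
  have \<tau>_eq: "AE x in M. tau_box x = ennreal (\<tau> x)"
    using AE_tau_box_finite by eventually_elim (simp add: \<tau>_def)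
  have b_eq: "AE x in M. inv_mu_box x = ennreal (b x)"
    using AE_index_charged
    by eventually_elim (simp add: inv_mu_box_def b_def emeasure_eq_measure charged_def inverse_ennreal inverse_eq_divide)
  have "AE x in M. 1 \<le> \<tau> x"
    using \<tau>_eq by eventually_elim (metis tau_box_ge_1 ennreal_1 ennreal_le_iff2 not_one_le_zero)
  moreover have "AE x in M. 1 \<le> b x"
    using AE_index_charged by eventually_elim (simp add: b_def charged_def)
  moreover have "(\<integral>\<^sup>+x. ennreal (b x powr (1 - q)) \<partial>M) < \<infinity>"
    using nn_integral_index[of w] finite_charged
    by (simp add: w_def b_def ennreal_mult_less_top less_top[symmetric] flip: ennreal_mult)
  moreover have "(\<integral>\<^sup>+x. ennreal (b x powr (1 - q) * (\<tau> x / b x)) \<partial>M) = (\<integral>\<^sup>+x. ennreal (b x powr (1 - q)) \<partial>M)"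
  proof -
    have "(\<integral>\<^sup>+x. ennreal (b x powr (1 - q) * (\<tau> x / b x)) \<partial>M)
        = (\<integral>\<^sup>+x. w (index x) * (ennreal (prob (cell (index x))) * tau_box x) \<partial>M)"
      using \<tau>_eq AE_index_charged
      by (intro nn_integral_cong_AE, eventually_elim)
         (simp add: w_def b_def \<tau>_def ennreal_mult' mult.commute)
    also have "\<dots> = (\<integral>\<^sup>+x. w (index x) \<partial>M)"
      by (rule nn_integral_weighted_tau_box)
    finally show ?thesis
      by (simp add: w_def b_def)
  qed
  ultimately have
    "0 \<le> q \<Longrightarrow> renyi M q (\<lambda>x. ennreal (\<tau> x)) \<le> renyi M q (\<lambda>x. ennreal (b x))"
    "q \<le> 0 \<Longrightarrow> renyi M q (\<lambda>x. ennreal (b x)) \<le> renyi M q (\<lambda>x. ennreal (\<tau> x))"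
    by (intro renyi_jensen; measurable)+
  then show "0 \<le> q \<Longrightarrow> renyi M q tau_box \<le> renyi M q inv_mu_box"
    and "q \<le> 0 \<Longrightarrow> renyi M q inv_mu_box \<le> renyi M q tau_box"
    by (simp_all add: renyi_cong_AE[OF \<tau>_eq] renyi_cong_AE[OF b_eq])
qed

lemma box_subset_ball: "x \<in> X \<Longrightarrow> cell (index x) \<subseteq> ball_on M x (CARD('n) * \<epsilon>)"
  using grid_index_eq_imp_dist_less[OF grid eps_pos]
  by (auto simp: ball_on_def mem_box_iff)

lemma ball_on_measurable: "x \<in> X \<Longrightarrow> 0 < \<delta> \<Longrightarrow> ball_on M x \<delta> \<in> sets M"
  using sets_ball by (simp add: ball_on_def space_eq)

text \<open>Enlarging the box to a ball shortens the return time and lowers the inverse measure. The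
  factor \<open>CARD('n)\<close> in the radius is a change of scale, which the limit
  ignores.\<close>

lemma renyi_ball_le_box:
  shows "renyi M q (\<lambda>x. return_time T (ball_on M x (CARD('n) * \<epsilon>)) x) \<le> renyi M q tau_box"
    and "renyi M q (\<lambda>x. inverse (emeasure M (ball_on M x (CARD('n) * \<epsilon>)))) \<le> renyi M q inv_mu_box"
proof -
  show "renyi M q (\<lambda>x. return_time T (ball_on M x (CARD('n) * \<epsilon>)) x) \<le> renyi M q tau_box"
    by (intro renyi_mono AE_I2) (simp add: tau_box_def return_time_antimono box_subset_ball space_eq)
  show "renyi M q (\<lambda>x. inverse (emeasure M (ball_on M x (CARD('n) * \<epsilon>)))) \<le> renyi M q inv_mu_box"
    using eps_pos
    by (intro renyi_mono AE_I2)
       (auto simp: inv_mu_box_def space_eq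
         intro!: ennreal_inverse_antimono emeasure_mono box_subset_ball ball_on_measurable)
qed

section \<open>Balls against blocks of neighbouring boxes\<close>

definition shift :: "('n \<Rightarrow> int) \<Rightarrow> ('n \<Rightarrow> int) \<Rightarrow> 'n \<Rightarrow> int" where
  "shift d k i = k i + d i"

definition prob_nbhd :: "('n \<Rightarrow> int) \<Rightarrow> real" where
  "prob_nbhd k = prob (\<Union>d\<in>neighbours. cell (shift d k))"

text \<open>For a fixed offset the shift is injective on indices, so the shifted sum is at most the
  unshifted one. The power of a sum costs the factor \<open>card neighbours powr q\<close>, the
  number of offsets one more \<open>card neighbours\<close>.\<close>

lemma sum_prob_nbhd_le:
  assumes "0 < q"
  shows "(\<Sum>k\<in>charged. prob_nbhd k powr q)
    \<le> card (neighbours :: ('n \<Rightarrow> int) set) powr (q + 1) * (\<Sum>k\<in>charged. prob (cell k) powr q)"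
proof -
  let ?N = "neighbours :: ('n \<Rightarrow> int) set" and ?a = "\<lambda>k. prob (cell k)"
  have shift_le: "(\<Sum>k\<in>charged. ?a (shift d k) powr q) \<le> (\<Sum>k\<in>charged. ?a k powr q)" for d
  proof -
    have inj: "inj_on (shift d) charged"
      by (intro inj_onI ext) (metis add_right_cancel shift_def)
    have "(\<Sum>k\<in>charged. ?a (shift d k) powr q) = (\<Sum>k\<in>shift d ` charged. ?a k powr q)"
      by (simp add: sum.reindex[OF inj])
    \<comment> \<open>Shifted boxes that are not charged contribute nothing, since
      \<open>0 powr q\<close> is 0.\<close>
    also have "\<dots> = (\<Sum>k\<in>shift d ` charged \<inter> charged. ?a k powr q)"
      using finite_charged by (intro sum.mono_neutral_right) (auto simp: charged_def zero_less_measure_iff)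
    also have "\<dots> \<le> (\<Sum>k\<in>charged. ?a k powr q)"
      using finite_charged by (intro sum_mono2) auto
    finally show ?thesis .
  qed
  have "prob_nbhd k powr q \<le> card ?N powr q * (\<Sum>d\<in>?N. ?a (shift d k) powr q)" for k
  proof -
    have "prob_nbhd k \<le> (\<Sum>d\<in>?N. ?a (shift d k))"
      unfolding prob_nbhd_def by (intro finite_measure_subadditive_finite finite_neighbours) auto
    then have "prob_nbhd k powr q \<le> (\<Sum>d\<in>?N. ?a (shift d k)) powr q"
      using assms by (intro powr_mono2) (auto simp: prob_nbhd_def)
    also have "\<dots> \<le> card ?N powr q * (\<Sum>d\<in>?N. ?a (shift d k) powr q)"
      using assms by (intro powr_sum_le finite_neighbours) auto
    finally show ?thesis .
  qed
  then have "(\<Sum>k\<in>charged. prob_nbhd k powr q) \<le> (\<Sum>k\<in>charged. card ?N powr q * (\<Sum>d\<in>?N. ?a (shift d k) powr q))"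
    by (rule sum_mono)
  also have "\<dots> = card ?N powr q * (\<Sum>d\<in>?N. \<Sum>k\<in>charged. ?a (shift d k) powr q)"
    unfolding sum_distrib_left[symmetric] by (subst sum.swap) simp
  also have "\<dots> \<le> card ?N powr q * (\<Sum>d\<in>?N. \<Sum>k\<in>charged. ?a k powr q)"
    by (rule mult_left_mono[OF sum_mono[OF shift_le]]) simp
  also have "\<dots> = card ?N powr (q + 1) * (\<Sum>k\<in>charged. ?a k powr q)"
    by (simp add: powr_add)
  finally show ?thesis .
qed

lemma prob_box_le_nbhd: "prob (cell k) \<le> prob_nbhd k"
  unfolding prob_nbhd_def
proof (rule finite_measure_mono)
  have "shift (\<lambda>_. 0) k = k" "(\<lambda>_. 0) \<in> neighbours"
    by (auto simp: shift_def neighbours_def)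
  then show "cell k \<subseteq> (\<Union>d\<in>neighbours. cell (shift d k))"
    by (metis UN_upper)
  show "(\<Union>d\<in>neighbours. cell (shift d k)) \<in> sets M"
    using finite_neighbours by (intro sets.finite_UN) auto
qed

lemma emeasure_ball_le_nbhd:
  assumes "x \<in> X"
  shows "emeasure M (ball_on M x \<epsilon>) \<le> ennreal (prob_nbhd (index x))"
  unfolding prob_nbhd_def emeasure_eq_measure[symmetric]
proof (rule emeasure_mono)
  show "ball_on M x \<epsilon> \<subseteq> (\<Union>d\<in>neighbours. cell (shift d (index x)))"
  proof
    fix y assume y: "y \<in> ball_on M x \<epsilon>"
    define d where "d = (\<lambda>i. index y i - index x i)"
    have "d \<in> neighbours"
      unfolding d_def using y by (intro grid_index_diff_neighbour grid eps_pos) (simp add: ball_on_def)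
    moreover have "y \<in> cell (shift d (index x))"
      using y by (auto simp: mem_box_iff d_def shift_def ball_on_def)
    ultimately show "y \<in> (\<Union>d\<in>neighbours. cell (shift d (index x)))" by blast
  qed
  show "(\<Union>d\<in>neighbours. cell (shift d (index x))) \<in> sets M"
    using finite_neighbours by (intro sets.finite_UN) auto
qed

section \<open>The box partition functions as integrals over the space\<close>

lemma Upsilon_tau_eq: "Upsilon_tau M T \<theta> q \<epsilon> = (\<integral>\<^sup>+x. epowr (tau_box x) (1 - q) \<partial>M)"
  unfolding Upsilon_tau_def tau_box_def
  by (subst infsum_boxes, simp add: box_eq_empty, subst nn_integral_boxes) simp_all

lemma Upsilon_log_tau_eq:
  "Upsilon_log_tau M T \<theta> \<epsilon> = - enn2ereal (\<integral>\<^sup>+x. e2ennreal (eln (tau_box x)) \<partial>M)"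
proof -
  have termwise: "ext_integral M (\<lambda>x. eln (inverse (return_time T (cell k) x)) * indicator (cell k) x)
      = - enn2ereal (\<integral>\<^sup>+x\<in>cell k. e2ennreal (eln (return_time T (cell k) x)) \<partial>M)" for k
  proof -
    \<comment> \<open>The value 1 outside the box has logarithm 0, which reproduces the indicator,
      and keeps \<open>g \<ge> 1\<close> everywhere.\<close>
    define g where "g x = (if x \<in> cell k then return_time T (cell k) x else 1)" for x
    have "(\<lambda>x. eln (inverse (return_time T (cell k) x)) * indicator (cell k) x) = (\<lambda>x. eln (inverse (g x)))"
      by (auto simp: g_def indicator_def)
    moreover have "(\<lambda>x. e2ennreal (eln (return_time T (cell k) x)) * indicator (cell k) x)
        = (\<lambda>x. e2ennreal (eln (g x)))"
      by (auto simp: g_def indicator_def e2ennreal_neg)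
    moreover have "1 \<le> g x" for x
      by (simp add: g_def return_time_ge_1)
    ultimately show ?thesis
      by (simp add: ext_integral_eln_inverse)
  qed
  have "Upsilon_log_tau M T \<theta> \<epsilon>
      = (\<Sum>k\<in>index ` space M. - enn2ereal (\<integral>\<^sup>+x\<in>cell k. e2ennreal (eln (return_time T (cell k) x)) \<partial>M))"
    unfolding Upsilon_log_tau_def termwise
    by (subst infsum_boxes) (simp_all add: box_eq_empty zero_ennreal.rep_eq)
  then show ?thesis
    unfolding sum_uminus_enn2ereal tau_box_def
    by (subst nn_integral_boxes) simp_all
qed

text \<open>With \<mu> the measure of a charged box,
  \<open>\<mu>^q = (1/\<mu>)^(1-q) * \<mu>\<close>: one factor of the measure is supplied by the
  integration.\<close>

lemma Upsilon_mu_eq: "Upsilon_mu M \<theta> q \<epsilon> = (\<integral>\<^sup>+x. epowr (inv_mu_box x) (1 - q) \<partial>M)"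
proof -
  have "ennreal (prob (cell k) powr q) = epowr (inverse (emeasure M (cell k))) (1 - q) * ennreal (prob (cell k))"
    if "k \<in> charged" for k
  proof -
    have "0 < prob (cell k)" using that by (simp add: charged_def)
    then show ?thesis
      by (simp add: epowr_inverse emeasure_eq_measure epowr_ennreal powr_diff flip: ennreal_mult)
  qed
  then have "Upsilon_mu M \<theta> q \<epsilon>
      = (\<Sum>k\<in>charged. epowr (inverse (emeasure M (cell k))) (1 - q) * ennreal (prob (cell k)))"
    using finite_charged by (simp add: Upsilon_mu_def flip: charged_def)
  then show ?thesis
    by (simp add: inv_mu_box_def nn_integral_index[of "\<lambda>k. epowr (inverse (emeasure M (cell k))) (1 - q)"])
qed

lemma Upsilon_log_mu_eq:
  "Upsilon_log_mu M \<theta> \<epsilon> = - enn2ereal (\<integral>\<^sup>+x. e2ennreal (eln (inv_mu_box x)) \<partial>M)"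
proof -
  have "ereal (prob (cell k) * ln (prob (cell k)))
      = - enn2ereal (e2ennreal (eln (inverse (emeasure M (cell k)))) * ennreal (prob (cell k)))"
    if "k \<in> charged" for k
  proof -
    have "0 < prob (cell k)" using that by (simp add: charged_def)
    moreover have "ln (prob (cell k)) \<le> 0"
      using \<open>0 < prob (cell k)\<close> by simp
    ultimately show ?thesis
      by (simp add: eln_inverse emeasure_eq_measure eln_ennreal enn2ereal_ennreal mult_le_0_iff
          mult.commute flip: ennreal_mult)
  qed
  then have "Upsilon_log_mu M \<theta> \<epsilon>
      = (\<Sum>k\<in>charged. - enn2ereal (e2ennreal (eln (inverse (emeasure M (cell k)))) * ennreal (prob (cell k))))"
    using finite_charged by (simp add: Upsilon_log_mu_def flip: charged_def)
  then show ?thesis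
    by (simp add: sum_uminus_enn2ereal inv_mu_box_def
        nn_integral_index[of "\<lambda>k. e2ennreal (eln (inverse (emeasure M (cell k))))"])
qed

end

text \<open>Boxes are compared with their neighbourhoods by \<open>renyi_sum_comparison\<close>, and
  a neighbourhood contains the ball of radius \<epsilon> around any point of its box. The constant
  is chosen before \<epsilon>, so that it disappears after division by
  \<open>- ln \<epsilon>\<close> in the limit.\<close>

lemma renyi_inv_mu_box_le_ball:
  fixes X :: "(real ^ 'n::finite) set"
  assumes "0 < q"
  shows "\<exists>C::real. \<forall>\<epsilon>. grid_system X T M \<theta> \<epsilon> \<longrightarrow>
      renyi M q (grid_system.inv_mu_box M \<theta> \<epsilon>)
        \<le> renyi M q (\<lambda>x. inverse (emeasure M (ball_on M x \<epsilon>))) + ereal C"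
proof -
  let ?N = "card (neighbours :: ('n \<Rightarrow> int) set)"
  have "(\<lambda>_. 0) \<in> (neighbours :: ('n \<Rightarrow> int) set)"
    by (simp add: neighbours_def)
  then have "0 < ?N"
    using finite_neighbours by (auto simp: card_gt_0_iff)
  then have "0 < ?N powr (q + 1)" by simp
  then obtain D where D: "\<And>(K :: ('n \<Rightarrow> int) set) a S.
      \<lbrakk>finite K; \<And>k. k \<in> K \<Longrightarrow> 0 < a k; \<And>k. k \<in> K \<Longrightarrow> a k \<le> S k; (\<Sum>k\<in>K. a k) = 1;
       (\<Sum>k\<in>K. S k powr q) \<le> ?N powr (q + 1) * (\<Sum>k\<in>K. a k powr q)\<rbrakk> \<Longrightarrow>
      (if q = 1 then \<Sum>k\<in>K. a k * - ln (a k)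
       else 1 / (1 - q) * ln (\<Sum>k\<in>K. a k * a k powr (q - 1)))
      \<le> (if q = 1 then \<Sum>k\<in>K. a k * - ln (S k)
         else 1 / (1 - q) * ln (\<Sum>k\<in>K. a k * S k powr (q - 1))) + D"
    using renyi_sum_comparison[OF assms] by blast
  show ?thesis
  proof (intro exI allI impI)
    fix \<epsilon> assume "grid_system X T M \<theta> \<epsilon>"
    then interpret grid_system X T M \<theta> \<epsilon> .
    have "renyi M q inv_mu_box = renyi M q (\<lambda>x. inverse (ennreal (prob (cell (index x)))))"
      by (simp add: inv_mu_box_def[abs_def] emeasure_eq_measure)
    also have "\<dots> \<le> renyi M q (\<lambda>x. inverse (ennreal (prob_nbhd (index x)))) + ereal D"
    proof -
      have pos: "0 < prob (cell k)" if "k \<in> charged" for k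
        using that by (simp add: charged_def)
      have pos': "0 < prob_nbhd k" if "k \<in> charged" for k
        using pos[OF that] prob_box_le_nbhd[of k] by linarith
      have "prob_nbhd k \<le> 1" for k
        by (simp add: prob_nbhd_def)
      then show ?thesis
        using D[of charged "\<lambda>k. prob (cell k)" prob_nbhd] finite_charged pos pos' prob_box_le_nbhd sum_prob_charged
          sum_prob_nbhd_le[OF assms]
        by (subst (1 2) renyi_index) auto
    qed
    also have "\<dots> \<le> renyi M q (\<lambda>x. inverse (emeasure M (ball_on M x \<epsilon>))) + ereal D"
      by (intro add_right_mono renyi_mono AE_I2 ennreal_inverse_antimono emeasure_ball_le_nbhd)
         (simp add: space_eq)
    finally show "renyi M q inv_mu_box
        \<le> renyi M q (\<lambda>x. inverse (emeasure M (ball_on M x \<epsilon>))) + ereal D" .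
  qed
qed

section \<open>Passage from fixed scales to the dimensions\<close>

theorem theorem3:
  fixes X :: "(real ^ 'n::finite) set" and T :: "real ^ 'n \<Rightarrow> real ^ 'n"
    and M :: "(real ^ 'n) measure" and \<theta> :: "'n grid" and q :: real and s :: side
  assumes "ergodic_system X T M" and "compact X" and "\<theta> \<in> grids"
  shows "(q > 0 \<longrightarrow>
            D_tau s M T q \<le> Delta_tau s M T \<theta> q \<and>
            Delta_tau s M T \<theta> q \<le> Delta_mu s M \<theta> q \<and>
            Delta_mu s M \<theta> q = D_mu s M q) \<and>
         (q \<le> 0 \<longrightarrow>
            Delta_tau s M T \<theta> q \<ge> Delta_mu s M \<theta> q \<and>
            Delta_mu s M \<theta> q \<ge> D_mu s M q) \<and>
         (q \<le> 0 \<longrightarrow> Delta_tau s M T \<theta> q \<ge> D_tau s M T q) \<and>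
         Delta_tau s M T \<theta> 0 = Delta_mu s M \<theta> 0"
proof -
  interpret ergodic_system X T M by fact
  have grid: "grid_system X T M \<theta> \<epsilon>" if "0 < \<epsilon>" for \<epsilon>
    using that assms compact_imp_bounded by unfold_locales auto
  define \<tau>\<^sub>A a where "\<tau>\<^sub>A = grid_system.tau_box T M \<theta>" and "a = grid_system.inv_mu_box M \<theta>"
  define \<tau>\<^sub>B b where "\<tau>\<^sub>B \<epsilon> x = return_time T (ball_on M x \<epsilon>) x"
    and "b \<epsilon> x = inverse (emeasure M (ball_on M x \<epsilon>))" for \<epsilon> x
  let ?lim = "\<lambda>g q. scale_limit s (\<lambda>\<epsilon>. renyi M q (g \<epsilon>) / ereal (- ln \<epsilon>))"
  have D_tau: "D_tau s M T q = ?lim \<tau>\<^sub>B q" for q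
    unfolding D_tau_def
    by (rule dimension_eq_renyi)
       (simp_all add: Gamma_tau_def Gamma_log_tau_def \<tau>\<^sub>B_def ext_integral_eln_inverse return_time_ge_1)
  have b_ge_1: "1 \<le> b \<epsilon> x" and a_ge_1: "1 \<le> a \<epsilon> x" if "0 < \<epsilon>" for \<epsilon> x
    using ennreal_inverse_antimono[OF emeasure_le_1]
    by (simp_all add: b_def a_def grid_system.inv_mu_box_def[OF grid[OF that]])
  have D_mu: "D_mu s M q = ?lim b q" for q
    unfolding D_mu_def
  proof (rule dimension_eq_renyi)
    fix \<epsilon> :: real assume "0 < \<epsilon>"
    show "Gamma_mu M q \<epsilon> = (\<integral>\<^sup>+x. epowr (b \<epsilon> x) (1 - q) \<partial>M)"
      by (simp add: Gamma_mu_def b_def epowr_inverse)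
    have "eln (emeasure M (ball_on M x \<epsilon>)) = eln (inverse (b \<epsilon> x))" for x
      by (simp add: b_def eln_inverse)
    then show "Gamma_log_mu M \<epsilon> = - enn2ereal (\<integral>\<^sup>+x. e2ennreal (eln (b \<epsilon> x)) \<partial>M)"
      using \<open>0 < \<epsilon>\<close> by (simp add: Gamma_log_mu_def ext_integral_eln_inverse b_ge_1)
  qed
  have Delta_tau: "Delta_tau s M T \<theta> q = ?lim \<tau>\<^sub>A q" for q
    unfolding Delta_tau_def
    by (rule dimension_eq_renyi)
       (simp_all add: \<tau>\<^sub>A_def grid_system.Upsilon_tau_eq[OF grid]
         grid_system.Upsilon_log_tau_eq[OF grid])
  have Delta_mu: "Delta_mu s M \<theta> q = ?lim a q" for q
    unfolding Delta_mu_def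
    by (rule dimension_eq_renyi)
       (simp_all add: a_def grid_system.Upsilon_mu_eq[OF grid]
         grid_system.Upsilon_log_mu_eq[OF grid])
  have nonneg: "0 \<le> renyi M q (\<tau>\<^sub>A \<epsilon>)" "0 \<le> renyi M q (a \<epsilon>)" "0 \<le> renyi M q (b \<epsilon>)"
    if "0 < \<epsilon>" for q \<epsilon>
    using that by (auto intro!: renyi_nonneg AE_I2 simp: a_ge_1 b_ge_1 \<tau>\<^sub>A_def grid_system.tau_box_ge_1[OF grid])
  have box_le: "?lim \<tau>\<^sub>A q \<le> ?lim a q" if "0 \<le> q" for q
    using nonneg grid_system.renyi_tau_box(1)[OF grid that]
    by (intro scale_limit_quotient_le[where r = 1 and C = 0]) (auto simp: \<tau>\<^sub>A_def a_def)
  have box_ge: "?lim a q \<le> ?lim \<tau>\<^sub>A q" if "q \<le> 0" for q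
    using nonneg grid_system.renyi_tau_box(2)[OF grid that]
    by (intro scale_limit_quotient_le[where r = 1 and C = 0]) (auto simp: \<tau>\<^sub>A_def a_def)
  \<comment> \<open>Here \<open>r\<close> is the dimension of the space: balls of radius
    \<open>r * \<epsilon>\<close> are compared with boxes of side \<epsilon>.\<close>
  have ball_le: "?lim \<tau>\<^sub>B q \<le> ?lim \<tau>\<^sub>A q" "?lim b q \<le> ?lim a q" for q
    using nonneg grid_system.renyi_ball_le_box[OF grid]
    by (intro scale_limit_quotient_le[where r = "real CARD('n)" and C = 0];
        auto simp: \<tau>\<^sub>A_def a_def \<tau>\<^sub>B_def[abs_def] b_def[abs_def])+
  have ball_ge: "?lim a q \<le> ?lim b q" if "0 < q" for q
  proof -
    obtain C where C: "\<forall>\<epsilon>. grid_system X T M \<theta> \<epsilon> \<longrightarrow> renyi M q (grid_system.inv_mu_box M \<theta> \<epsilon>)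
        \<le> renyi M q (\<lambda>x. inverse (emeasure M (ball_on M x \<epsilon>))) + ereal C"
      using renyi_inv_mu_box_le_ball[OF \<open>0 < q\<close>] by metis
    have "renyi M q (a \<epsilon>) \<le> renyi M q (b \<epsilon>) + ereal C" if "0 < \<epsilon>" for \<epsilon>
      using C grid[OF that] by (simp add: a_def b_def[abs_def])
    then show ?thesis
      using nonneg by (intro scale_limit_quotient_le[where r = 1 and C = C]) auto
  qed
  \<comment> \<open>Equality at \<open>q = 0\<close> arises because \<open>box_le\<close> and
    \<open>box_ge\<close> both cover that exponent; for \<open>q > 0\<close>, \<open>ball_le\<close>
    and \<open>ball_ge\<close> give equality of the measure dimensions.\<close>
  show ?thesis
    unfolding D_tau D_mu Delta_tau Delta_mu
    using box_le box_ge ball_le ball_ge by (auto intro: antisym order.trans)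
qed

end
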